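(* Let $G$ be a compact Hausdorff group, $X$ a complete operator space, $\nu\in M_{ac}(G,X)$ and $f\in L^1(\nu)$. Then for any $x'\in X'$ and $[\pi]\in\widehat{G}$, $$\langle\langle\widehat{f}^\nu(\pi),x'\rangle\rangle=[\langle\widehat{f}^\nu(\pi)_{ij},x'\rangle]=[\widehat{fh_{x'}}(\pi)_{ij}]=\widehat{fh_{x'}}(\pi)=\widehat{f}_\nu(x')(\pi).$$
   Context: $m_G$ is normalized Haar measure on $G$; $X'$ is the dual of $X$ with closed unit ball $B_{X'}$. $M_{ac}(G,X)$ is the space of $\sigma$-additive $X$-valued vector measures $\nu$ on the Borel sets of $G$ with $\lim_{m_G(A)\to0}\nu(A)=0$. For $x'\in X'$, $\langle\nu,x'\rangle(A)=\langle\nu(A),x'\rangle$, $|\langle\nu,x'\rangle|$ is its total variation, and $h_{x'}\in L^1(G)$ is given by $d\langle\nu,x'\rangle=h_{x'}\,dm_G$. $f:G\to\mathbb{C}$ is in $L^1_w(\nu)$ if $f\in L^1(|\langle\nu,x'\rangle|)$ for all $x'$ (then $fh_{x'}\in L^1(G)$); $f\in L^1(\nu)$ if moreover for each Borel $A$ there is a unique $\int_Af\,d\nu\in X$ with $\langle\int_Af\,d\nu,x'\rangle=\int_Af\,d\langle\nu,x'\rangle$ for all $x'$. $\widehat G$ is the set of classes of irreducible unitary representations $\pi$ of $G$, $d_\pi=\dim\mathcal{H}_\pi$, $\pi(t)_{ij}=\langle\pi(t)e_j^\pi,e_i^\pi\rangle$ for a fixed ordered orthonormal basis. For $f\in L^1(\nu)$,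 $\widehat f^\nu(\pi)\in M_{d_\pi}(X)$ has entries $\widehat f^\nu(\pi)_{ij}=\frac1{d_\pi}\int_Gf(t)\overline{\pi(t)_{ji}}\,d\nu(t)$. For $g\in L^1(G)$, $\widehat g(\pi)_{ij}=\frac1{d_\pi}\int_Gg(t)\overline{\pi(t)_{ji}}\,dm_G(t)$. For $f\in L^1_w(\nu)$, $\widehat f_\nu(x')(\pi):=\widehat{fh_{x'}}(\pi)$. For a matrix $[x_{ij}]$ over $X$ and $x'\in X'$, $\langle\langle[x_{ij}],x'\rangle\rangle:=[\langle x_{ij},x'\rangle]$. *)

theory Defs
  imports "HOL-Analysis.Set_Integral" "Jordan_Normal_Form.Matrix"
begin

section \<open>Complex normed spaces, Hilbert spaces and operator spaces\<close>

class complex_normed_vector = real_normed_vector +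
  fixes scaleC :: "complex \<Rightarrow> 'a \<Rightarrow> 'a"  (infixr "*\<^sub>C" 75)
  assumes scaleC_add_right: "a *\<^sub>C (x + y) = a *\<^sub>C x + a *\<^sub>C y"
    and scaleC_add_left: "(a + b) *\<^sub>C x = a *\<^sub>C x + b *\<^sub>C x"
    and scaleC_scaleC: "a *\<^sub>C (b *\<^sub>C x) = (a * b) *\<^sub>C x"
    and scaleC_one: "1 *\<^sub>C x = x"
    and scaleR_scaleC: "r *\<^sub>R x = complex_of_real r *\<^sub>C x"
    and norm_scaleC: "norm (a *\<^sub>C x) = cmod a * norm x"

global_interpretation complex_vs: vector_space "scaleC :: complex \<Rightarrow> 'a \<Rightarrow> 'a::complex_normed_vector"
  by unfold_locales (rule scaleC_add_right scaleC_add_left scaleC_scaleC scaleC_one)+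

text \<open>The inner product is linear in its first argument.\<close>

class complex_inner = complex_normed_vector +
  fixes cinner :: "'a \<Rightarrow> 'a \<Rightarrow> complex"
  assumes cinner_commute: "cinner x y = cnj (cinner y x)"
    and cinner_add_left: "cinner (x + y) z = cinner x z + cinner y z"
    and cinner_scaleC_left: "cinner (a *\<^sub>C x) y = a * cinner x y"
    and norm_eq_sqrt_cinner: "norm x = sqrt (Re (cinner x x))"

text \<open>The norm of a complex matrix as an operator between the \<open>\<ell>\<^sup>2\<close> spaces.\<close>

definition mat_opnorm :: "complex mat \<Rightarrow> real" where
  "mat_opnorm \<alpha> = Sup {L2_set (\<lambda>i. cmod (vec_index (\<alpha> *\<^sub>v v) i)) {..<dim_row \<alpha>} | v.
     v \<in> carrier_vec (dim_col \<alpha>) \<and> L2_set (\<lambda>i. cmod (vec_index v i)) {..<dim_col \<alpha>} \<le> 1}"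

text \<open>The product \<open>\<alpha> V \<beta>\<close> of a matrix \<open>V\<close> over a complex vector space with scalar matrices.\<close>

definition bimod_mult :: "complex mat \<Rightarrow> 'a::complex_normed_vector mat \<Rightarrow> complex mat \<Rightarrow> 'a mat" where
  "bimod_mult \<alpha> V \<beta> = Matrix.mat (dim_row \<alpha>) (dim_col \<beta>) (\<lambda>(i, j).
     \<Sum>k<dim_row V. \<Sum>l<dim_col V. (\<alpha> $$ (i, k) * \<beta> $$ (l, j)) *\<^sub>C V $$ (k, l))"

text \<open>Abstract operator spaces: a norm on each \<open>M\<^sub>n(X)\<close>, subject to Ruan's axioms.
  Only the values of \<open>matnorm\<close> on square matrices matter.\<close>

locale operator_space =
  fixes matnorm :: "'a::complex_normed_vector mat \<Rightarrow> real"
  assumes matnorm_eq_0_iff: "V \<in> carrier_mat n n \<Longrightarrow> matnorm V = 0 \<longleftrightarrow> V = 0\<^sub>m n n"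
    and matnorm_triangle:
      "V \<in> carrier_mat n n \<Longrightarrow> W \<in> carrier_mat n n \<Longrightarrow> matnorm (V + W) \<le> matnorm V + matnorm W"
    and matnorm_scaleC: "V \<in> carrier_mat n n \<Longrightarrow> matnorm (map_mat (scaleC c) V) = cmod c * matnorm V"
    and matnorm_one_by_one: "matnorm (Matrix.mat 1 1 (\<lambda>_. x)) = norm x"
    and matnorm_direct_sum: "V \<in> carrier_mat n n \<Longrightarrow> W \<in> carrier_mat p p \<Longrightarrow>
      matnorm (four_block_mat V (0\<^sub>m n p) (0\<^sub>m p n) W) = max (matnorm V) (matnorm W)"
    and matnorm_bimod_mult:
      "\<alpha> \<in> carrier_mat p n \<Longrightarrow> V \<in> carrier_mat n n \<Longrightarrow> \<beta> \<in> carrier_mat n p \<Longrightarrow>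
       matnorm (bimod_mult \<alpha> V \<beta>) \<le> mat_opnorm \<alpha> * matnorm V * mat_opnorm \<beta>"

locale complete_operator_space = operator_space matnorm
  for matnorm :: "'a::{complex_normed_vector, complete_space} mat \<Rightarrow> real"

text \<open>The topological dual \<open>X'\<close>.\<close>

definition cdual :: "('x::complex_normed_vector \<Rightarrow> complex) set" where
  "cdual = {x'. bounded_linear x' \<and> (\<forall>c x. x' (c *\<^sub>C x) = c * x' x)}"

definition matrix_pairing :: "'x mat \<Rightarrow> ('x \<Rightarrow> complex) \<Rightarrow> complex mat" where
  "matrix_pairing V x' = map_mat x' V"


section \<open>Haar measure and vector measures\<close>

text \<open>Groups are written additively, as in the class \<^class>\<open>topological_group_add\<close>; they need not be
  commutative. On a compact Hausdorff group there is exactly one measure with this property.\<close>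

definition normalized_haar :: "'g::topological_group_add measure \<Rightarrow> bool" where
  "normalized_haar m \<longleftrightarrow>
     sets m = sets borel \<and>
     emeasure m UNIV = 1 \<and>
     (\<forall>g. \<forall>A\<in>sets borel. emeasure m ((\<lambda>x. g + x) ` A) = emeasure m A) \<and>
     (\<forall>A\<in>sets borel. emeasure m A = (INF U\<in>{U. open U \<and> A \<subseteq> U}. emeasure m U)) \<and>
     (\<forall>A\<in>sets borel. emeasure m A = (SUP K\<in>{K. compact K \<and> K \<subseteq> A}. emeasure m K))"

text \<open>Vector measures are functions on all sets, of which only the values on Borel sets matter.\<close>

definition vector_measure :: "('g::topological_space set \<Rightarrow> 'x::real_normed_vector) \<Rightarrow> bool" where
  "vector_measure \<nu> \<longleftrightarrow>
     (\<forall>A :: nat \<Rightarrow> 'g set. range A \<subseteq> sets borel \<longrightarrow> disjoint_family A \<longrightarrow>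
        (\<lambda>n. \<nu> (A n)) sums \<nu> (\<Union>n. A n))"

definition M_ac :: "'g::topological_space measure \<Rightarrow> ('g set \<Rightarrow> 'x::real_normed_vector) set" where
  "M_ac m = {\<nu>. vector_measure \<nu> \<and>
     (\<forall>\<epsilon>>0. \<exists>\<delta>>0. \<forall>A\<in>sets borel. measure m A < \<delta> \<longrightarrow> norm (\<nu> A) < \<epsilon>)}"

definition scalar_measure :: "('g set \<Rightarrow> 'x) \<Rightarrow> ('x \<Rightarrow> complex) \<Rightarrow> 'g set \<Rightarrow> complex" where
  "scalar_measure \<nu> x' = (\<lambda>A. x' (\<nu> A))"

definition total_variation :: "('g::topological_space set \<Rightarrow> complex) \<Rightarrow> 'g measure" where
  "total_variation \<mu> = measure_of UNIV (sets borel)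
     (\<lambda>E. SUP P\<in>{P. finite P \<and> disjoint P \<and> P \<subseteq> sets borel \<and> \<Union>P = E}. \<Sum>B\<in>P. ennreal (cmod (\<mu> B)))"

text \<open>The upper variation \<open>\<mu>\<^sup>+\<close> of a real measure \<open>\<mu>\<close>. Since \<^const>\<open>ennreal\<close> sends negative
  numbers to 0, sets of negative measure do not contribute to the supremum.\<close>

definition upper_variation :: "('g::topological_space set \<Rightarrow> real) \<Rightarrow> 'g measure" where
  "upper_variation \<mu> = measure_of UNIV (sets borel)
     (\<lambda>E. SUP F\<in>{F\<in>sets borel. F \<subseteq> E}. ennreal (\<mu> F))"

text \<open>Integration against a complex measure, through the Jordan decompositions of its real and
  imaginary parts.\<close>

definition cm_integral ::
  "('g::topological_space set \<Rightarrow> complex) \<Rightarrow> ('g \<Rightarrow> complex) \<Rightarrow> complex" where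
  "cm_integral \<mu> f =
     (integral\<^sup>L (upper_variation (\<lambda>A. Re (\<mu> A))) f - integral\<^sup>L (upper_variation (\<lambda>A. - Re (\<mu> A))) f)
     + \<i> * (integral\<^sup>L (upper_variation (\<lambda>A. Im (\<mu> A))) f - integral\<^sup>L (upper_variation (\<lambda>A. - Im (\<mu> A))) f)"

definition cm_set_integral ::
  "('g::topological_space set \<Rightarrow> complex) \<Rightarrow> 'g set \<Rightarrow> ('g \<Rightarrow> complex) \<Rightarrow> complex" where
  "cm_set_integral \<mu> A f = cm_integral \<mu> (\<lambda>t. indicator A t *\<^sub>R f t)"

definition L1_weak ::
  "('g::topological_space set \<Rightarrow> 'x::complex_normed_vector) \<Rightarrow> ('g \<Rightarrow> complex) set" where
  "L1_weak \<nu> = {f. \<forall>x'\<in>cdual. integrable (total_variation (scalar_measure \<nu> x')) f}"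

definition is_vm_integral ::
  "('g::topological_space set \<Rightarrow> 'x::complex_normed_vector) \<Rightarrow> 'g set \<Rightarrow> ('g \<Rightarrow> complex) \<Rightarrow> 'x \<Rightarrow> bool" where
  "is_vm_integral \<nu> A f x \<longleftrightarrow> (\<forall>x'\<in>cdual. x' x = cm_set_integral (scalar_measure \<nu> x') A f)"

definition L1 ::
  "('g::topological_space set \<Rightarrow> 'x::complex_normed_vector) \<Rightarrow> ('g \<Rightarrow> complex) set" where
  "L1 \<nu> = {f \<in> L1_weak \<nu>. \<forall>A\<in>sets borel. \<exists>!x. is_vm_integral \<nu> A f x}"

definition vm_integral ::
  "('g::topological_space set \<Rightarrow> 'x::complex_normed_vector) \<Rightarrow> 'g set \<Rightarrow> ('g \<Rightarrow> complex) \<Rightarrow> 'x" where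
  "vm_integral \<nu> A f = (THE x. is_vm_integral \<nu> A f x)"

text \<open>The Radon--Nikodym density of a complex measure, determined up to null sets.\<close>

definition density_of :: "'g::topological_space measure \<Rightarrow> ('g set \<Rightarrow> complex) \<Rightarrow> 'g \<Rightarrow> complex" where
  "density_of m \<mu> = (SOME h. integrable m h \<and> (\<forall>A\<in>sets borel. \<mu> A = (LINT t:A|m. h t)))"


section \<open>Irreducible unitary representations\<close>

text \<open>A representation is a Hilbert space \<open>H\<close>, given as a complete subspace of an ambient inner
  product space, together with the operators \<open>\<pi> t\<close>, whose values off \<open>H\<close> are irrelevant.
  Ranging over all ambient spaces \<open>'h\<close> gives all Hilbert spaces.\<close>

type_synonym ('g, 'h) rep = "'h set \<times> ('g \<Rightarrow> 'h \<Rightarrow> 'h)"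

definition clinear_on :: "'h::complex_normed_vector set \<Rightarrow> ('h \<Rightarrow> 'h) \<Rightarrow> bool" where
  "clinear_on H T \<longleftrightarrow> (\<forall>u\<in>H. \<forall>v\<in>H. T (u + v) = T u + T v) \<and> (\<forall>c. \<forall>v\<in>H. T (c *\<^sub>C v) = c *\<^sub>C T v)"

definition unitary_on :: "'h::complex_inner set \<Rightarrow> 'h set \<Rightarrow> ('h \<Rightarrow> 'h) \<Rightarrow> bool" where
  "unitary_on H K T \<longleftrightarrow>
     clinear_on H T \<and> bij_betw T H K \<and> (\<forall>u\<in>H. \<forall>v\<in>H. cinner (T u) (T v) = cinner u v)"

definition unitary_rep :: "('g::topological_group_add, 'h::complex_inner) rep \<Rightarrow> bool" where
  "unitary_rep = (\<lambda>(H, \<pi>).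
     complex_vs.subspace H \<and> complete H \<and>
     (\<forall>t. unitary_on H H (\<pi> t)) \<and>
     (\<forall>s t. \<forall>v\<in>H. \<pi> (s + t) v = \<pi> s (\<pi> t v)) \<and>
     (\<forall>v\<in>H. continuous_on UNIV (\<lambda>t. \<pi> t v)))"

definition irreducible_rep :: "('g::topological_group_add, 'h::complex_inner) rep \<Rightarrow> bool" where
  "irreducible_rep = (\<lambda>(H, \<pi>).
     unitary_rep (H, \<pi>) \<and> H \<noteq> {0} \<and>
     (\<forall>K. K \<subseteq> H \<and> complex_vs.subspace K \<and> closed K \<and> (\<forall>t. \<pi> t ` K \<subseteq> K) \<longrightarrow> K = {0} \<or> K = H))"

definition rep_equiv :: "(('g::topological_group_add, 'h::complex_inner) rep \<times> ('g, 'h) rep) set" where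
  "rep_equiv = {((H, \<pi>), (K, \<sigma>)). irreducible_rep (H, \<pi>) \<and> irreducible_rep (K, \<sigma>) \<and>
     (\<exists>U. unitary_on H K U \<and> (\<forall>t. \<forall>v\<in>H. U (\<pi> t v) = \<sigma> t (U v)))}"

definition dual_object :: "('g::topological_group_add, 'h::complex_inner) rep set set" where
  "dual_object = {\<rho>. irreducible_rep \<rho>} // rep_equiv"

definition rep_dim :: "('g, 'h::complex_inner) rep \<Rightarrow> nat" where
  "rep_dim = (\<lambda>(H, \<pi>). complex_vs.dim H)"

text \<open>The dimension of an infinite-dimensional space is 0 by convention, so for
  \<open>H \<noteq> {0}\<close> the following forces \<open>H\<close> to be finite-dimensional.\<close>

definition ordered_onb :: "('g, 'h::complex_inner) rep \<Rightarrow> (nat \<Rightarrow> 'h) \<Rightarrow> bool" where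
  "ordered_onb = (\<lambda>(H, \<pi>) e.
     (\<forall>i<rep_dim (H, \<pi>). \<forall>j<rep_dim (H, \<pi>). cinner (e i) (e j) = (if i = j then 1 else 0)) \<and>
     complex_vs.span (e ` {..<rep_dim (H, \<pi>)}) = H)"

definition rep_coeff :: "('g, 'h::complex_inner) rep \<Rightarrow> (nat \<Rightarrow> 'h) \<Rightarrow> 'g \<Rightarrow> nat \<Rightarrow> nat \<Rightarrow> complex" where
  "rep_coeff = (\<lambda>(H, \<pi>) e t i j. cinner (\<pi> t (e j)) (e i))"


section \<open>Fourier transforms\<close>

text \<open>Matrix indices start at 0.\<close>

definition fourier_vm ::
  "('g::topological_space set \<Rightarrow> 'x::complex_normed_vector) \<Rightarrow> ('g \<Rightarrow> complex) \<Rightarrow>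
   ('g, 'h::complex_inner) rep \<Rightarrow> (nat \<Rightarrow> 'h) \<Rightarrow> 'x mat" where
  "fourier_vm \<nu> f \<rho> e = Matrix.mat (rep_dim \<rho>) (rep_dim \<rho>) (\<lambda>(i, j).
     (1 / of_nat (rep_dim \<rho>)) *\<^sub>C vm_integral \<nu> UNIV (\<lambda>t. f t * cnj (rep_coeff \<rho> e t j i)))"

definition fourier ::
  "'g measure \<Rightarrow> ('g \<Rightarrow> complex) \<Rightarrow> ('g, 'h::complex_inner) rep \<Rightarrow> (nat \<Rightarrow> 'h) \<Rightarrow> complex mat" where
  "fourier m g \<rho> e = Matrix.mat (rep_dim \<rho>) (rep_dim \<rho>) (\<lambda>(i, j).
     1 / of_nat (rep_dim \<rho>) * (LINT t|m. g t * cnj (rep_coeff \<rho> e t j i)))"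

definition fourier_weak ::
  "'g::topological_space measure \<Rightarrow> ('g set \<Rightarrow> 'x::complex_normed_vector) \<Rightarrow> ('g \<Rightarrow> complex) \<Rightarrow>
   ('x \<Rightarrow> complex) \<Rightarrow> ('g, 'h::complex_inner) rep \<Rightarrow> (nat \<Rightarrow> 'h) \<Rightarrow> complex mat" where
  "fourier_weak m \<nu> f x' = fourier m (\<lambda>t. f t * density_of m (scalar_measure \<nu> x') t)"

end

theory Submission
  imports Defs
begin

text \<open>
The matrix entries are, up to the factor \<open>1 / d\<close>, integrals of \<open>f\<close> against a conjugated matrix
coefficient \<open>\<phi>\<close> of the representation. So everything rests on one point: for a bounded Borel
function \<open>\<phi>\<close> the vector integral of \<open>f \<phi>\<close> exists, and a functional \<open>x'\<close> sends it to
\<open>\<integral> f \<phi> h\<^sub>x\<^sub>' dm\<close> (\<open>bounded_multiplier_integral\<close>). Matrix coefficients are continuous on a compact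
group, hence bounded and Borel.

Existence holds for indicators \<open>\<phi>\<close> by definition of \<open>L1\<close>, and then for simple functions by
linearity. A bounded Borel function is a uniform limit of simple functions, so it remains to see
that \<open>\<phi> \<mapsto> \<integral> f \<phi> d\<nu>\<close> is bounded for the supremum norm: completeness of \<open>X\<close> then gives the
integral of the limit. The integrals with \<open>\<bar>\<phi>\<bar> \<le> 1\<close> form a weakly bounded set, as
\<open>\<bar>\<integral> f \<phi> h\<^sub>x\<^sub>'\<bar> \<le> \<integral> \<bar>f h\<^sub>x\<^sub>'\<bar>\<close>, and weakly bounded sets are norm bounded
(\<open>weakly_bounded_imp_norm_bounded\<close>, which uses the Hahn--Banach theorem in the form of norming
functionals).

On the scalar side, absolute continuity gives the densities \<open>h\<^sub>x\<^sub>'\<close> (\<open>complex_density\<close>: the upper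
variations of the real and imaginary parts and of their negatives are finite measures, to which
the Radon--Nikodym theorem for positive measures applies). With them, the upper and the total
variation of \<open>h dm\<close> are the measures with densities \<open>h\<^sup>+\<close> (for real \<open>h\<close>) and \<open>\<bar>h\<bar>\<close> (\<open>upper_variation_density\<close>,
\<open>total_variation_density\<close>), so that integration against the complex measure is integration of
the product with \<open>h\<close>, and \<open>f\<close> lies in the weak \<open>L\<^sup>1\<close> space only if all \<open>f h\<^sub>x\<^sub>'\<close> are integrable.
\<close>

section \<open>Norming functionals and weakly bounded sets\<close>

text \<open>
Domination by the norm is part of the notion because it bounds all these functionals from below,
by \<open>- norm v\<close> at \<open>v\<close>; chains therefore have pointwise infima.
\<close>

definition dominated_sublinear :: "('a::real_normed_vector \<Rightarrow> real) \<Rightarrow> bool" where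
  "dominated_sublinear p \<longleftrightarrow> (\<forall>v w. p (v + w) \<le> p v + p w) \<and> (\<forall>r v. 0 \<le> r \<longrightarrow> p (r *\<^sub>R v) = r * p v) \<and>
     (\<forall>v. p v \<le> norm v)"

lemma dominated_sublinearD:
  assumes "dominated_sublinear p"
  shows "p (v + w) \<le> p v + p w" "0 \<le> r \<Longrightarrow> p (r *\<^sub>R v) = r * p v" "p v \<le> norm v" "p 0 = 0"
    "- p (- v) \<le> p v" "- norm v \<le> p v"
proof -
  show 1: "p (v + w) \<le> p v + p w" "0 \<le> r \<Longrightarrow> p (r *\<^sub>R v) = r * p v" "p v \<le> norm v" for v w r
    using assms by (auto simp: dominated_sublinear_def)
  show 2: "p 0 = 0" using 1(2)[of 0 0] by simp
  show 3: "- p (- v) \<le> p v" using 1(1)[of v "- v"] 2 by simp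
  show "- norm v \<le> p v" using 3 1(3)[of "-v"] by simp
qed

text \<open>
The functional \<open>lower_along p y\<close> lies below \<open>p\<close>, is again sublinear, and takes at most the value
\<open>- p y\<close> at \<open>- y\<close>, as a linear functional with value \<open>p y\<close> at \<open>y\<close> would. This one construction
serves twice below: a minimal sublinear functional equals all its lowerings and is therefore linear, and starting from the lowering of
the norm along \<open>x\<close> makes the linear functional attain the norm at \<open>x\<close>.
\<close>

definition lower_along :: "('a::real_normed_vector \<Rightarrow> real) \<Rightarrow> 'a \<Rightarrow> 'a \<Rightarrow> real" where
  "lower_along p y v = (INF t\<in>{0..}. p (v + t *\<^sub>R y) - t * p y)"

lemma lower_along_bdd:
  assumes "dominated_sublinear p"
  shows "bdd_below ((\<lambda>t. p (v + t *\<^sub>R y) - t * p y) ` {0..})"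
proof (rule bdd_belowI2)
  fix t :: real assume "t \<in> {0..}"
  then have "t * p y = p (t *\<^sub>R y)" using dominated_sublinearD(2)[OF assms] by simp
  also have "\<dots> \<le> p (v + t *\<^sub>R y) + p (- v)"
    using dominated_sublinearD(1)[OF assms, of "v + t *\<^sub>R y" "- v"] by simp
  finally show "- p (- v) \<le> p (v + t *\<^sub>R y) - t * p y" by simp
qed

lemma lower_along_le:
  assumes "dominated_sublinear p" "0 \<le> t"
  shows "lower_along p y v \<le> p (v + t *\<^sub>R y) - t * p y"
  unfolding lower_along_def using assms by (intro cINF_lower lower_along_bdd) auto

lemma dominated_sublinear_lower_along:
  assumes p: "dominated_sublinear p"
  shows "dominated_sublinear (lower_along p y)"
proof -
  note le = lower_along_le[OF p]
  have "lower_along p y (v + w) \<le> lower_along p y v + lower_along p y w" for v w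
  proof -
    have "lower_along p y (v + w) - lower_along p y w \<le> p (v + t *\<^sub>R y) - t * p y" if t: "0 \<le> t" for t
    proof -
      have "lower_along p y (v + w) - (p (v + t *\<^sub>R y) - t * p y) \<le> p (w + s *\<^sub>R y) - s * p y" if s: "0 \<le> s" for s
        using le[of "t + s" y "v + w"] t s dominated_sublinearD(1)[OF p, of "v + t *\<^sub>R y" "w + s *\<^sub>R y"]
        by (simp add: algebra_simps)
      then have "lower_along p y (v + w) - (p (v + t *\<^sub>R y) - t * p y) \<le> lower_along p y w"
        unfolding lower_along_def[of p y w] by (intro cINF_greatest) auto
      then show ?thesis by simp
    qed
    then have "lower_along p y (v + w) - lower_along p y w \<le> lower_along p y v"
      unfolding lower_along_def[of p y v] by (intro cINF_greatest) auto
    then show ?thesis by simp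
  qed
  moreover have "lower_along p y (r *\<^sub>R v) = r * lower_along p y v" if "0 \<le> r" for r v
  proof -
    have half: "lower_along p y (r *\<^sub>R v) \<le> r * lower_along p y v" if r: "0 < r" for r v
    proof -
      have "lower_along p y (r *\<^sub>R v) / r \<le> p (v + t *\<^sub>R y) - t * p y" if t: "0 \<le> t" for t
      proof -
        have "p (r *\<^sub>R v + (r * t) *\<^sub>R y) = r * p (v + t *\<^sub>R y)"
          using dominated_sublinearD(2)[OF p, of r "v + t *\<^sub>R y"] r by (simp add: algebra_simps)
        then show ?thesis
          using le[of "r * t" y "r *\<^sub>R v"] r t by (simp add: field_simps)
      qed
      then have "lower_along p y (r *\<^sub>R v) / r \<le> lower_along p y v"
        unfolding lower_along_def[of p y v] by (intro cINF_greatest) auto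
      then show ?thesis using r by (simp add: field_simps)
    qed
    have zero: "lower_along p y 0 = 0"
    proof -
      have "p (t *\<^sub>R y) - t * p y = 0" if "0 \<le> t" for t using that dominated_sublinearD(2)[OF p] by simp
      then show ?thesis unfolding lower_along_def by (simp cong: INF_cong_simp)
    qed
    show ?thesis
    proof (cases "r = 0")
      case False
      with that have r: "0 < r" by simp
      have "lower_along p y v \<le> inverse r * lower_along p y (r *\<^sub>R v)"
        using half[of "inverse r" "r *\<^sub>R v"] r by simp
      with half[OF r, of v] r show ?thesis by (simp add: field_simps)
    qed (simp add: zero)
  qed
  moreover have "lower_along p y v \<le> norm v" for v
    using le[of 0 y v] dominated_sublinearD(3)[OF p, of v] by simp
  ultimately show ?thesis by (simp add: dominated_sublinear_def)
qed

lemma dominated_sublinear_INF_chain: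
  assumes C: "C \<noteq> {}" "\<And>p. p \<in> C \<Longrightarrow> dominated_sublinear p" and chain: "\<And>p q. p \<in> C \<Longrightarrow> q \<in> C \<Longrightarrow> p \<le> q \<or> q \<le> p"
  shows "dominated_sublinear (\<lambda>v. INF p\<in>C. p v)" "q \<in> C \<Longrightarrow> (\<lambda>v. INF p\<in>C. p v) \<le> q"
proof -
  have bdd: "bdd_below ((\<lambda>p. p v) ` C)" for v
    using dominated_sublinearD(6)[OF C(2)] by (intro bdd_belowI2[of _ "- norm v"]) auto
  have le: "(INF p\<in>C. p v) \<le> q v" if "q \<in> C" for q v
    using that bdd by (intro cINF_lower)
  then show "q \<in> C \<Longrightarrow> (\<lambda>v. INF p\<in>C. p v) \<le> q" by (simp add: le_fun_def)
  have "(INF p\<in>C. p (v + w)) \<le> (INF p\<in>C. p v) + (INF p\<in>C. p w)" for v w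
  proof -
    have "(INF p\<in>C. p (v + w)) - (INF p\<in>C. p w) \<le> p v" if p: "p \<in> C" for p
    proof -
      have "(INF p\<in>C. p (v + w)) - p v \<le> q w" if q: "q \<in> C" for q
      proof -
        obtain r where r: "r \<in> C" "r \<le> p" "r \<le> q"
          using chain[OF p q] p q by auto
        have "(INF p\<in>C. p (v + w)) \<le> r v + r w"
          using le[OF r(1), of "v + w"] dominated_sublinearD(1)[OF C(2)[OF r(1)], of v w] by simp
        with r(2,3) show ?thesis by (simp add: le_fun_def) (smt (verit))
      qed
      then have "(INF p\<in>C. p (v + w)) - p v \<le> (INF p\<in>C. p w)"
        using C(1) by (intro cINF_greatest)
      then show ?thesis by simp
    qed
    then have "(INF p\<in>C. p (v + w)) - (INF p\<in>C. p w) \<le> (INF p\<in>C. p v)"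
      using C(1) by (intro cINF_greatest)
    then show ?thesis by simp
  qed
  moreover have "(INF p\<in>C. p (r *\<^sub>R v)) = r * (INF p\<in>C. p v)" if "0 \<le> r" for r v
  proof -
    have "(INF p\<in>C. p (r *\<^sub>R v)) = (INF p\<in>C. r * p v)"
      using dominated_sublinearD(2)[OF C(2)] that by (intro INF_cong) auto
    also have "\<dots> = r * (INF p\<in>C. p v)"
    proof (cases "r = 0")
      case True with C(1) show ?thesis by simp
    next
      case False
      with that have r: "0 < r" by simp
      have "mono ((*) r)" using r by (simp add: mono_def)
      moreover have "continuous (at_right (Inf ((\<lambda>p. p v) ` C))) ((*) r)"
        by (intro continuous_intros)
      ultimately show ?thesis
        using continuous_at_Inf_mono[of "(*) r" "(\<lambda>p. p v) ` C"] C(1) bdd by (simp add: image_image)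
    qed
    finally show ?thesis .
  qed
  moreover have "(INF p\<in>C. p v) \<le> norm v" for v
  proof -
    obtain p where "p \<in> C" using C(1) by auto
    then show ?thesis using le[of p v] dominated_sublinearD(3)[OF C(2), of p v] by simp
  qed
  ultimately show "dominated_sublinear (\<lambda>v. INF p\<in>C. p v)" by (simp add: dominated_sublinear_def)
qed

lemma dominated_sublinear_norm: "dominated_sublinear norm"
  by (simp add: dominated_sublinear_def norm_triangle_ineq)

text \<open>
Zorn's lemma gives a minimal sublinear functional below the lowering of the norm along \<open>x\<close>;
minimality makes it linear.
\<close>

lemma real_norming_functional:
  fixes x :: "'a::real_normed_vector"
  obtains u where "\<And>v w. u (v + w) = u v + u w" "\<And>r v. u (r *\<^sub>R v) = r * u v"
    "\<And>v. \<bar>u v\<bar> \<le> norm v" "u x = norm x"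
proof -
  let ?A = "{p. dominated_sublinear p \<and> p \<le> lower_along norm x}"
  let ?P = "\<lambda>p q :: 'a \<Rightarrow> real. q \<le> p"
  have "\<exists>m\<in>?A. \<forall>p\<in>?A. p \<le> m \<longrightarrow> p = m"
  proof (rule predicate_Zorn)
    show "partial_order_on ?A (relation_of ?P ?A)"
      by (rule partial_order_on_relation_ofI) auto
    fix C assume C: "C \<in> Chains (relation_of ?P ?A)"
    show "\<exists>u\<in>?A. \<forall>a\<in>C. u \<le> a"
    proof (cases "C = {}")
      case True
      then show ?thesis using dominated_sublinear_lower_along[OF dominated_sublinear_norm] by auto
    next
      case False
      have CA: "p \<in> C \<Longrightarrow> p \<in> ?A" for p
        using C unfolding Chains_def relation_of_def by blast
      have ch: "p \<in> C \<Longrightarrow> q \<in> C \<Longrightarrow> p \<le> q \<or> q \<le> p" for p q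
        using C unfolding Chains_def relation_of_def by blast
      note inf = dominated_sublinear_INF_chain[of C, OF False _ ch]
      obtain q where q: "q \<in> C" using False by auto
      have "(\<lambda>v. INF p\<in>C. p v) \<le> q" using CA by (intro inf(2) q) auto
      also have "q \<le> lower_along norm x" using CA[OF q] by simp
      finally have "(\<lambda>v. INF p\<in>C. p v) \<in> ?A" using inf(1) CA by auto
      moreover have "\<forall>a\<in>C. (\<lambda>v. INF p\<in>C. p v) \<le> a" using inf(2) CA by auto
      ultimately show ?thesis by blast
    qed
  qed
  then obtain m where m: "dominated_sublinear m" "m \<le> lower_along norm x"
    and minimal: "\<And>p. dominated_sublinear p \<Longrightarrow> p \<le> m \<Longrightarrow> p = m"
    by (auto intro: order_trans)
  have super: "m v + m y \<le> m (v + y)" for v y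
  proof -
    have "lower_along m y = m"
      using lower_along_le[OF m(1), of 0 y]
      by (intro minimal dominated_sublinear_lower_along m) (simp add: le_fun_def)
    then show ?thesis using lower_along_le[OF m(1), of 1 y v] by simp
  qed
  have add: "m (v + y) = m v + m y" for v y
    using super[of v y] dominated_sublinearD(1)[OF m(1), of v y] by simp
  have neg: "m (- v) = - m v" for v
    using add[of v "- v"] dominated_sublinearD(4)[OF m(1)] by simp
  have scale: "m (r *\<^sub>R v) = r * m v" for r v
  proof (cases "0 \<le> r")
    case False
    then have "m ((- r) *\<^sub>R v) = - r * m v" by (intro dominated_sublinearD(2)[OF m(1)]) simp
    then show ?thesis using neg[of "r *\<^sub>R v"] by simp
  qed (rule dominated_sublinearD(2)[OF m(1)])
  have "m (- x) \<le> lower_along norm x (- x)" using m(2) by (simp add: le_fun_def)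
  also have "\<dots> \<le> - norm x" using lower_along_le[OF dominated_sublinear_norm, of 1 x "- x"] by simp
  finally have "norm x \<le> m x" by (simp add: neg)
  with dominated_sublinearD(3)[OF m(1), of x] have "m x = norm x" by simp
  moreover have "\<bar>m v\<bar> \<le> norm v" for v
    using dominated_sublinearD(3,6)[OF m(1), of v] by (simp add: abs_le_iff)
  ultimately show thesis using that[of m] add scale by blast
qed

lemma cdualD:
  assumes "x' \<in> cdual"
  shows "bounded_linear x'" "x' (v + w) = x' v + x' w" "x' (a *\<^sub>C v) = a * x' v" "x' (v - w) = x' v - x' w"
    "x' 0 = 0" "x' (\<Sum>i\<in>I. g i) = (\<Sum>i\<in>I. x' (g i))"
proof -
  show b: "bounded_linear x'" "x' (a *\<^sub>C v) = a * x' v" using assms by (auto simp: cdual_def)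
  interpret bounded_linear x' by fact
  show "x' (v + w) = x' v + x' w" "x' (v - w) = x' v - x' w" "x' 0 = 0"
     "x' (\<Sum>i\<in>I. g i) = (\<Sum>i\<in>I. x' (g i))" by (auto simp: add diff sum)
qed

lemma cdualI:
  assumes "\<And>v w. x' (v + w) = x' v + x' w" "\<And>a v. x' (a *\<^sub>C v) = a * x' v"
    "\<And>v. cmod (x' v) \<le> K * norm v"
  shows "x' \<in> cdual"
proof -
  have "bounded_linear x'"
    by (rule bounded_linear_intro[where K = K])
       (use assms in \<open>auto simp: scaleR_scaleC scaleR_conv_of_real mult.commute\<close>)
  then show ?thesis using assms by (simp add: cdual_def)
qed

text \<open>
The usual passage from a real functional \<open>u\<close> to the complex one \<open>u v - \<i> u (\<i> v)\<close>. Rotating \<open>v\<close> until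
the value is real shows that the norm does not grow.
\<close>

lemma cdual_norming_functional:
  fixes x :: "'x::complex_normed_vector"
  obtains x' where "x' \<in> cdual" "\<And>v. cmod (x' v) \<le> norm v" "x' x = norm x"
proof -
  obtain u where u: "\<And>v w. u (v + w) = u v + u w" "\<And>r v. u (r *\<^sub>R v) = r * u v"
    "\<And>v::'x. \<bar>u v\<bar> \<le> norm v" "u x = norm x"
    using real_norming_functional[of x] by blast
  define x' where "x' v = Complex (u v) (- u (\<i> *\<^sub>C v))" for v
  have iC: "(Complex a b) *\<^sub>C v = a *\<^sub>R v + b *\<^sub>R \<i> *\<^sub>C v" for a b and v :: 'x
    by (simp add: scaleR_scaleC scaleC_scaleC scaleC_add_left[symmetric] Complex_eq mult.commute)
  have ii: "\<i> *\<^sub>C \<i> *\<^sub>C v = - v" for v :: 'x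
    using iC[of "-1" 0 v] by (simp add: scaleC_scaleC complex_eq_iff Complex_eq)
  have i_real: "\<i> *\<^sub>C r *\<^sub>R v = r *\<^sub>R \<i> *\<^sub>C v" for r and v :: 'x
    by (simp add: scaleR_scaleC scaleC_scaleC mult.commute)
  have neg: "u (- v) = - u v" for v using u(2)[of "-1" v] by simp
  have add: "x' (v + w) = x' v + x' w" for v w
    by (simp add: x'_def scaleC_add_right u(1) complex_eq_iff)
  have scale: "x' (a *\<^sub>C v) = a * x' v" for a v
  proof -
    obtain r s where a: "a = Complex r s" by (cases a)
    have "a *\<^sub>C v = r *\<^sub>R v + s *\<^sub>R \<i> *\<^sub>C v" by (simp only: a iC)
    moreover from this have "\<i> *\<^sub>C a *\<^sub>C v = r *\<^sub>R \<i> *\<^sub>C v + s *\<^sub>R (- v)"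
      by (simp only: scaleC_add_right i_real ii)
    ultimately show ?thesis
      by (simp only: x'_def u(1,2) neg) (simp add: a complex_eq_iff)
  qed
  have bound: "cmod (x' v) \<le> norm v" for v
  proof (cases "x' v = 0")
    case False
    \<comment> \<open>the rotation that makes the value at \<open>v\<close> equal to its modulus\<close>
    define b where "b = cnj (x' v) / cmod (x' v)"
    have cb: "cmod b = 1" using False by (simp add: b_def norm_divide)
    have "x' (b *\<^sub>C v) = cmod (x' v)"
      using False complex_norm_square[of "x' v"]
      by (simp add: scale b_def power2_eq_square field_simps)
    then have "cmod (x' v) = u (b *\<^sub>C v)" by (simp add: x'_def complex_eq_iff)
    also have "\<dots> \<le> norm (b *\<^sub>C v)" using u(3)[of "b *\<^sub>C v"] by simp
    finally show ?thesis by (simp add: norm_scaleC cb)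
  qed simp
  have "x' x = norm x"
  proof -
    have "(u x)\<^sup>2 + (u (\<i> *\<^sub>C x))\<^sup>2 \<le> (norm x)\<^sup>2"
      using power_mono[OF bound[of x], of 2] by (simp add: x'_def cmod_power2)
    then have "u (\<i> *\<^sub>C x) = 0" using u(4) by simp
    then show ?thesis by (simp add: x'_def u(4) complex_eq_iff)
  qed
  moreover have "x' \<in> cdual" by (rule cdualI[where K = 1]) (use add scale bound in auto)
  ultimately show thesis using that bound by blast
qed

text \<open>
A gliding hump argument in place of Baire's theorem. If \<open>x\<^sub>n \<in> S\<close> has norm above \<open>n 3\<^sup>n\<close>, a
functional is built by adding successively \<open>\<plusminus> 3\<^sup>-\<^sup>n \<eta>\<^sub>n\<close> with \<open>\<eta>\<^sub>n\<close> norming \<open>x\<^sub>n\<close>. One of the two signs makes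
the modulus of the new value at \<open>x\<^sub>n\<close> at least \<open>3\<^sup>-\<^sup>n \<parallel>x\<^sub>n\<parallel>\<close>, since two numbers whose distance is
twice this cannot both be smaller; all later steps together change it by at most half as much.
So the limit functional has modulus above \<open>n / 2\<close> at \<open>x\<^sub>n\<close>.
\<close>

lemma weakly_bounded_imp_norm_bounded:
  fixes S :: "'x::complex_normed_vector set"
  assumes weak: "\<And>x'. x' \<in> cdual \<Longrightarrow> \<exists>B. \<forall>x\<in>S. cmod (x' x) \<le> B"
  shows "\<exists>B. \<forall>x\<in>S. norm x \<le> B"
proof (rule ccontr)
  assume "\<not> ?thesis"
  then have "\<exists>x\<in>S. norm x > real n * 3 ^ n" for n by (meson not_le)
  then obtain x where x: "\<And>n. x n \<in> S" "\<And>n. norm (x n) > real n * 3 ^ n" by metis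
  define step where "step n \<xi> \<zeta> \<longleftrightarrow> ((\<forall>v. cmod (\<zeta> v - \<xi> v) \<le> norm v / 3 ^ n) \<and>
    norm (x n) / 3 ^ n \<le> cmod (\<zeta> (x n)))" for n and \<xi> \<zeta> :: "'x \<Rightarrow> complex"
  have "\<exists>F. \<forall>n. F n \<in> cdual \<and> step n (F n) (F (Suc n))"
  proof (rule dependent_nat_choice)
    show "\<exists>\<xi>. \<xi> \<in> cdual" by (meson cdual_norming_functional)
    fix \<xi> :: "'x \<Rightarrow> complex" and n assume \<xi>: "\<xi> \<in> cdual"
    obtain \<eta> where \<eta>: "\<eta> \<in> cdual" "\<And>v. cmod (\<eta> v) \<le> norm v" "\<eta> (x n) = norm (x n)"
      using cdual_norming_functional[of "x n"] by blast
    define a where "a = norm (x n) / 3 ^ n"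
    have "2 * a \<le> cmod (\<xi> (x n) + a) + cmod (\<xi> (x n) - a)"
      using norm_triangle_ineq4[of "\<xi> (x n) + a" "\<xi> (x n) - a"] 
      by (simp add: a_def norm_mult norm_divide norm_power flip: mult_2)
    then obtain \<sigma> :: real where \<sigma>: "\<bar>\<sigma>\<bar> = 1" "a \<le> cmod (\<xi> (x n) + \<sigma> * a)"
    proof (cases "a \<le> cmod (\<xi> (x n) + a)")
      case True
      then show ?thesis using that[of 1] by simp
    next
      case False
      with \<open>2 * a \<le> _\<close> show ?thesis using that[of "-1"] by simp
    qed
    define \<delta> where "\<delta> v = of_real (\<sigma> / 3 ^ n) * \<eta> v" for v
    have bd: "cmod (\<delta> v) \<le> norm v / 3 ^ n" for v
      using \<eta>(2)[of v] \<sigma>(1) by (simp add: \<delta>_def norm_mult norm_divide norm_power divide_right_mono)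
    have "\<delta> \<in> cdual"
      by (rule cdualI[where K = "1 / 3 ^ n"])
         (use bd cdualD(2,3)[OF \<eta>(1)] in \<open>auto simp: \<delta>_def algebra_simps add_divide_distrib\<close>)
    obtain K where K: "\<And>v. cmod (\<xi> v) \<le> norm v * K"
      using bounded_linear.bounded[OF cdualD(1)[OF \<xi>]] by auto
    have "(\<lambda>v. \<xi> v + \<delta> v) \<in> cdual"
    proof (rule cdualI[where K = "K + 1 / 3 ^ n"])
      show "cmod (\<xi> v + \<delta> v) \<le> (K + 1 / 3 ^ n) * norm v" for v
        using norm_triangle_ineq[of "\<xi> v" "\<delta> v"] K[of v] bd[of v] by (simp add: algebra_simps)
    qed (use cdualD[OF \<xi>] cdualD[OF \<open>\<delta> \<in> cdual\<close>] in \<open>auto simp: algebra_simps\<close>)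
    moreover have "step n \<xi> (\<lambda>v. \<xi> v + \<delta> v)"
    proof -
      have "\<xi> (x n) + \<delta> (x n) = \<xi> (x n) + \<sigma> * a" by (simp add: \<delta>_def \<eta>(3) a_def)
      then show ?thesis
        using bd \<sigma>(2) unfolding step_def a_def by simp
    qed
    ultimately show "\<exists>\<zeta>. \<zeta> \<in> cdual \<and> step n \<xi> \<zeta>" by blast
  qed
  then obtain F where F: "\<And>n. F n \<in> cdual" "\<And>n. step n (F n) (F (Suc n))" by blast
  have diff: "cmod (F (Suc n) v - F n v) \<le> norm v / 3 ^ n" for n v
    using F(2)[of n] by (simp add: step_def)
  have sm: "summable (\<lambda>k. norm v / 3 ^ (k + n))" "(\<Sum>k. norm v / 3 ^ (k + n)) = norm v / 3 ^ n * (3 / 2)" for v :: 'x and n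
  proof -
    have "(\<lambda>k. norm v / 3 ^ n * (1 / 3) ^ k) sums (norm v / 3 ^ n * (1 / (1 - 1 / 3)))"
      by (intro sums_mult geometric_sums) simp
    then have "(\<lambda>k. norm v / 3 ^ (k + n)) sums (norm v / 3 ^ n * (3 / 2))"
      by (simp add: power_add field_simps)
    then show "summable (\<lambda>k. norm v / 3 ^ (k + n))" "(\<Sum>k. norm v / 3 ^ (k + n)) = norm v / 3 ^ n * (3 / 2)"
      by (auto simp: sums_iff)
  qed
  have sF: "summable (\<lambda>k. F (Suc (k + n)) v - F (k + n) v)" for v n
    by (rule summable_comparison_test'[OF sm(1)[of v n], of 0]) (use diff in auto)
  define \<xi> where "\<xi> v = F 0 v + (\<Sum>k. F (Suc k) v - F k v)" for v
  have tail: "cmod (\<xi> v - F n v) \<le> norm v / 3 ^ n * (3 / 2)" for v n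
  proof -
    have "(\<Sum>k. F (Suc k) v - F k v) = (\<Sum>k. F (Suc (k + n)) v - F (k + n) v) + (\<Sum>k<n. F (Suc k) v - F k v)"
      using suminf_split_initial_segment[of "\<lambda>k. F (Suc k) v - F k v" n] sF[of 0 v] by simp
    also have "(\<Sum>k<n. F (Suc k) v - F k v) = F n v - F 0 v" by (rule sum_lessThan_telescope)
    finally have "\<xi> v - F n v = (\<Sum>k. F (Suc (k + n)) v - F (k + n) v)" by (simp add: \<xi>_def)
    also have "cmod \<dots> \<le> (\<Sum>k. norm v / 3 ^ (k + n))"
      by (rule norm_suminf_le[OF _ sm(1)]) (use diff in auto)
    finally show ?thesis by (simp add: sm(2))
  qed
  obtain K where K: "\<And>v. cmod (F 0 v) \<le> norm v * K"
    using bounded_linear.bounded[OF cdualD(1)[OF F(1)[of 0]]] by auto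
  have "\<xi> \<in> cdual"
  proof (rule cdualI[where K = "K + 3 / 2"])
    show "\<xi> (v + w) = \<xi> v + \<xi> w" for v w
      using suminf_add[OF sF[of 0 v, simplified] sF[of 0 w, simplified]]
      by (simp add: \<xi>_def cdualD(2)[OF F(1)] algebra_simps)
    show "\<xi> (a *\<^sub>C v) = a * \<xi> v" for a v
      using suminf_mult[OF sF[of 0 v, simplified], of a]
      by (simp add: \<xi>_def cdualD(3)[OF F(1)] algebra_simps)
    show "cmod (\<xi> v) \<le> (K + 3 / 2) * norm v" for v
      using tail[of v 0] K[of v] norm_triangle_ineq[of "\<xi> v - F 0 v" "F 0 v"] by (simp add: algebra_simps)
  qed
  then obtain B where B: "\<And>n. cmod (\<xi> (x n)) \<le> B" using weak x(1) by blast
  obtain n where n: "2 * B < real n" using reals_Archimedean2 by blast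
  have "norm (x n) / 3 ^ n \<le> cmod (F (Suc n) (x n))" using F(2)[of n] by (simp add: step_def)
  also have "\<dots> \<le> cmod (\<xi> (x n)) + cmod (\<xi> (x n) - F (Suc n) (x n))"
    using norm_triangle_ineq4[of "\<xi> (x n)" "\<xi> (x n) - F (Suc n) (x n)"] by simp
  also have "\<dots> \<le> B + norm (x n) / 3 ^ n / 2"
    using tail[of "x n" "Suc n"] B[of n] by simp
  finally have "norm (x n) / 3 ^ n \<le> 2 * B" by simp
  moreover have "real n < norm (x n) / 3 ^ n" using x(2)[of n] by (simp add: field_simps)
  ultimately show False using n by simp
qed

section \<open>Densities and variations of scalar measures\<close>

lemma vector_measureD:
  fixes A :: "nat \<Rightarrow> 'g::topological_space set"
  assumes "vector_measure \<nu>" "range A \<subseteq> sets borel" "disjoint_family A"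
  shows "(\<lambda>n. \<nu> (A n)) sums \<nu> (\<Union>n. A n)"
  using assms unfolding vector_measure_def by blast

lemma vector_measure_empty:
  assumes "vector_measure \<nu>"
  shows "\<nu> {} = 0"
proof -
  have "(\<lambda>n::nat. \<nu> {}) sums \<nu> (\<Union>n::nat. {})"
    by (rule vector_measureD[OF assms]) (auto simp: disjoint_family_on_def)
  then have "(\<lambda>n::nat. \<nu> {}) \<longlonglongrightarrow> 0"
    using summable_LIMSEQ_zero sums_summable by blast
  then show ?thesis using LIMSEQ_unique tendsto_const by blast
qed

lemma vector_measure_Un:
  assumes \<nu>: "vector_measure \<nu>" and AB: "A \<in> sets borel" "B \<in> sets borel" "A \<inter> B = {}"
  shows "\<nu> (A \<union> B) = \<nu> A + \<nu> B"
proof -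
  have "(\<lambda>n. \<nu> (binaryset A B n)) sums \<nu> (\<Union>n. binaryset A B n)"
    using AB by (intro vector_measureD[OF \<nu>])
      (auto simp: range_binaryset_eq disjoint_family_on_def binaryset_def)
  moreover have "(\<lambda>n. \<nu> (binaryset A B n)) sums (\<nu> A + \<nu> B)"
    by (rule binaryset_sums) (rule vector_measure_empty[OF \<nu>])
  ultimately show ?thesis by (simp add: UN_binaryset_eq sums_unique2)
qed

lemma vector_measure_Diff:
  assumes \<nu>: "vector_measure \<nu>" and AB: "A \<in> sets borel" "B \<in> sets borel" "A \<subseteq> B"
  shows "\<nu> (B - A) = \<nu> B - \<nu> A"
proof -
  have "A \<union> (B - A) = B" using AB(3) by auto
  then show ?thesis using vector_measure_Un[OF \<nu>, of A "B - A"] AB by auto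
qed

lemma vector_measure_compose:
  assumes "bounded_linear T" "vector_measure \<nu>"
  shows "vector_measure (\<lambda>A. T (\<nu> A))"
  using assms bounded_linear.sums unfolding vector_measure_def by blast

text \<open>
The variations are defined by \<^const>\<open>measure_of\<close>, which yields the zero measure when the set
function is not countably additive. Agreement with a measure known in advance settles this
point and computes the variation at once.
\<close>

lemma measure_of_borel_eqI:
  fixes D :: "'g::topological_space measure"
  assumes D: "sets D = sets borel" and F: "\<And>E. E \<in> sets borel \<Longrightarrow> F E = emeasure D E"
  shows "measure_of UNIV (sets borel) F = D"
proof -
  have sp: "space D = UNIV" using sets_eq_imp_space_eq[OF D] by simp
  have "measure_of UNIV (sets borel) F = measure_of UNIV (sets borel) (emeasure D)"
    using F sigma_algebra.sigma_sets_eq[OF sets.sigma_algebra_axioms[of borel]] by (intro measure_of_eq) auto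
  also have "\<dots> = D" using measure_of_of_measure[of D] by (simp add: sp D)
  finally show ?thesis .
qed

context
  fixes \<mu> :: "'g::topological_space set \<Rightarrow> real"
  assumes \<mu>: "vector_measure \<mu>"
begin

lemma sets_upper_variation: "sets (upper_variation \<mu>) = sets borel" "space (upper_variation \<mu>) = UNIV"
  using sets.sets_measure_of_eq[of borel] sets.space_measure_of_eq[of borel] by (auto simp: upper_variation_def)

text \<open>
Countable additivity: superadditivity comes from uniting subsets of disjoint sets,
subadditivity from cutting a subset of the union into its pieces. Negative values of \<open>\<mu>\<close> enter
the supremum as 0, which is harmless because the empty set is among the subsets.
\<close>

lemma emeasure_upper_variation:
  assumes E: "E \<in> sets borel"
  shows "emeasure (upper_variation \<mu>) E = (SUP F\<in>{F\<in>sets borel. F \<subseteq> E}. ennreal (\<mu> F))"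
proof -
  define uv where "uv E = (SUP F\<in>{F\<in>sets borel. F \<subseteq> E}. ennreal (\<mu> F))" for E
  have upper: "ennreal (\<mu> F) \<le> uv E" if "F \<in> sets borel" "F \<subseteq> E" for E F
    unfolding uv_def using that by (intro SUP_upper) auto
  have mono: "uv A \<le> uv B" if "A \<subseteq> B" for A B
    unfolding uv_def using that by (intro SUP_subset_mono) auto
  have empty: "uv {} = 0"
  proof -
    have "{F \<in> sets borel. F \<subseteq> {}} = {{} :: 'g set}" by auto
    then show ?thesis by (simp add: uv_def vector_measure_empty[OF \<mu>])
  qed
  have super: "uv A + uv B \<le> uv (A \<union> B)" if AB: "A \<inter> B = {}" for A B
  proof -
    have ne: "{F \<in> sets borel. F \<subseteq> E} \<noteq> {}" for E :: "'g set" by auto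
    have "ennreal (\<mu> F) + ennreal (\<mu> G) \<le> uv (A \<union> B)"
      if F: "F \<in> sets borel" "F \<subseteq> A" and G: "G \<in> sets borel" "G \<subseteq> B" for F G
    proof (cases "0 \<le> \<mu> F \<and> 0 \<le> \<mu> G")
      case True
      have "F \<inter> G = {}" using AB F G by auto
      then have "ennreal (\<mu> F) + ennreal (\<mu> G) = ennreal (\<mu> (F \<union> G))"
        using True vector_measure_Un[OF \<mu> F(1) G(1)] by (simp add: ennreal_plus)
      also have "\<dots> \<le> uv (A \<union> B)" using F G by (intro upper) auto
      finally show ?thesis .
    next
      case False
      then consider "ennreal (\<mu> F) = 0" | "ennreal (\<mu> G) = 0"
        using ennreal_neg by (meson linorder_linear)
      then show ?thesis
        using upper[of F "A \<union> B"] upper[of G "A \<union> B"] F G by cases auto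
    qed
    then have "(SUP F\<in>{F\<in>sets borel. F \<subseteq> A}. SUP G\<in>{G\<in>sets borel. G \<subseteq> B}. ennreal (\<mu> F) + ennreal (\<mu> G)) \<le> uv (A \<union> B)"
      by (intro SUP_least) auto
    also have "(SUP F\<in>{F\<in>sets borel. F \<subseteq> A}. SUP G\<in>{G\<in>sets borel. G \<subseteq> B}. ennreal (\<mu> F) + ennreal (\<mu> G)) = uv A + uv B"
      unfolding uv_def by (simp only: ennreal_SUP_add_right[OF ne, symmetric] ennreal_SUP_add_left[OF ne])
    finally show ?thesis .
  qed
  have "countably_additive (sets borel) uv"
  proof (rule countably_additiveI)
    fix A :: "nat \<Rightarrow> 'g set" assume A: "range A \<subseteq> sets borel" "disjoint_family A"
    show "(\<Sum>i. uv (A i)) = uv (\<Union>i. A i)"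
    proof (rule antisym)
      have "(\<Sum>i<n. uv (A i)) \<le> uv (\<Union>i<n. A i)" for n
      proof (induction n)
        case (Suc n)
        have "(\<Union>i<n. A i) \<inter> A n = {}"
        proof -
          have "A i \<inter> A n = {}" if "i < n" for i
            using A(2) that by (simp add: disjoint_family_on_def)
          then show ?thesis by blast
        qed
        from super[OF this] Suc show ?case
        proof -
          assume IH: "(\<Sum>i<n. uv (A i)) \<le> uv (\<Union>i<n. A i)"
            and step: "uv (\<Union>i<n. A i) + uv (A n) \<le> uv ((\<Union>i<n. A i) \<union> A n)"
          have "(\<Sum>i<Suc n. uv (A i)) = (\<Sum>i<n. uv (A i)) + uv (A n)" by simp
          also have "\<dots> \<le> uv (\<Union>i<n. A i) + uv (A n)" by (intro add_right_mono IH)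
          also note step
          also have "(\<Union>i<n. A i) \<union> A n = (\<Union>i<Suc n. A i)" by (auto simp: lessThan_Suc)
          finally show ?thesis .
        qed
      qed (simp add: empty)
      then have "(\<Sum>i<n. uv (A i)) \<le> uv (\<Union>i. A i)" for n
        by (rule order_trans) (intro mono, auto)
      then show "(\<Sum>i. uv (A i)) \<le> uv (\<Union>i. A i)"
        by (intro suminf_le_const) auto
      have "ennreal (\<mu> F) \<le> (\<Sum>i. uv (A i))" if F: "F \<in> sets borel" "F \<subseteq> (\<Union>i. A i)" for F
      proof -
        have "(\<lambda>n. \<mu> (F \<inter> A n)) sums \<mu> (\<Union>n. F \<inter> A n)"
          using A F by (intro vector_measureD[OF \<mu>]) (auto simp: disjoint_family_on_def)
        also have "(\<Union>n. F \<inter> A n) = F" using F by auto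
        finally have "(\<lambda>n. \<Sum>i<n. \<mu> (F \<inter> A i)) \<longlonglongrightarrow> \<mu> F" by (simp add: sums_def)
        then have "(\<lambda>n. ennreal (\<Sum>i<n. \<mu> (F \<inter> A i))) \<longlonglongrightarrow> ennreal (\<mu> F)"
          by (rule tendsto_ennrealI)
        moreover have "ennreal (\<Sum>i<n. \<mu> (F \<inter> A i)) \<le> (\<Sum>i. uv (A i))" for n
        proof -
          have "ennreal (\<Sum>i<n. \<mu> (F \<inter> A i)) \<le> ennreal (\<Sum>i<n. max 0 (\<mu> (F \<inter> A i)))"
            by (intro ennreal_leI sum_mono) auto
          also have "\<dots> = (\<Sum>i<n. ennreal (\<mu> (F \<inter> A i)))"
            by (subst sum_ennreal[symmetric]) (auto simp del: sum_ennreal simp: max_def ennreal_neg intro!: sum.cong)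
          also have "\<dots> \<le> (\<Sum>i<n. uv (A i))"
            using A F by (intro sum_mono upper) auto
          also have "\<dots> \<le> (\<Sum>i. uv (A i))" by (intro sum_le_suminf) auto
          finally show ?thesis .
        qed
        ultimately show ?thesis using LIMSEQ_le_const2 by blast
      qed
      then show "uv (\<Union>i. A i) \<le> (\<Sum>i. uv (A i))"
        unfolding uv_def[of "\<Union>i. A i"] by (intro SUP_least) auto
    qed
  qed
  moreover have "upper_variation \<mu> = measure_of UNIV (sets borel) uv"
    by (simp add: upper_variation_def uv_def[abs_def])
  ultimately have "emeasure (upper_variation \<mu>) E = uv E"
    using E empty by (intro emeasure_measure_of) (auto simp: sets_upper_variation positive_def sets.sigma_sets_eq[of borel, unfolded space_borel])
  then show ?thesis by (simp add: uv_def)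
qed

text \<open>
A set \<open>E\<close> of infinite upper variation has a subset \<open>F\<close> such that \<open>\<mu> F\<close> exceeds \<open>\<bar>\<mu> E\<bar> + 1\<close>, so
that \<open>\<mu>\<close> exceeds 1 in modulus on both \<open>F\<close> and \<open>E - F\<close>, and one of the two has infinite upper variation
again. Keeping that one and discarding the other, forever, gives disjoint sets on which \<open>\<mu>\<close> is
larger than 1 in modulus, against the convergence of the sum of their measures.
\<close>

lemma finite_upper_variation: "finite_measure (upper_variation \<mu>)"
proof (rule ccontr)
  let ?U = "upper_variation \<mu>"
  assume "\<not> finite_measure ?U"
  then have inf: "emeasure ?U UNIV = \<infinity>"
    using finite_measureI[of ?U] by (auto simp: sets_upper_variation)
  have split: "\<exists>E'. E' \<in> sets borel \<and> emeasure ?U E' = \<infinity> \<and> E' \<subseteq> E \<and> 1 < \<bar>\<mu> (E - E')\<bar>"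
    if E: "E \<in> sets borel" "emeasure ?U E = \<infinity>" for E
  proof -
    have "ennreal (\<bar>\<mu> E\<bar> + 1) < (SUP F\<in>{F\<in>sets borel. F \<subseteq> E}. ennreal (\<mu> F))"
      unfolding emeasure_upper_variation[OF E(1), symmetric] E(2) by simp
    then obtain F where F: "F \<in> sets borel" "F \<subseteq> E" "ennreal (\<bar>\<mu> E\<bar> + 1) < ennreal (\<mu> F)"
      by (auto simp: less_SUP_iff)
    then have gt: "\<bar>\<mu> E\<bar> + 1 < \<mu> F" by (simp add: ennreal_less_iff del: ennreal_plus)
    have EF: "\<mu> (E - F) = \<mu> E - \<mu> F" by (rule vector_measure_Diff[OF \<mu> F(1) E(1) F(2)])
    have "emeasure ?U F + emeasure ?U (E - F) = emeasure ?U (F \<union> (E - F))"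
      using E F by (intro plus_emeasure) (auto simp: sets_upper_variation)
    also have "F \<union> (E - F) = E" using F by auto
    finally consider "emeasure ?U F = \<infinity>" | "emeasure ?U (E - F) = \<infinity>"
      using E(2) by (auto simp: ennreal_add_eq_top)
    then show ?thesis
    proof cases
      case 1
      then show ?thesis using F EF gt by (intro exI[of _ F]) auto
    next
      case 2
      moreover have "E - (E - F) = F" using F by auto
      ultimately show ?thesis using F E gt by (intro exI[of _ "E - F"]) auto
    qed
  qed
  have "\<exists>E. \<forall>n. (E n \<in> sets borel \<and> emeasure ?U (E n) = \<infinity>) \<and> (E (Suc n) \<subseteq> E n \<and> 1 < \<bar>\<mu> (E n - E (Suc n))\<bar>)"
  proof (rule dependent_nat_choice)
    show "\<exists>E. E \<in> sets borel \<and> emeasure ?U E = \<infinity>" using inf by (intro exI[of _ UNIV]) simp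
    show "\<exists>E'. (E' \<in> sets borel \<and> emeasure ?U E' = \<infinity>) \<and> E' \<subseteq> E \<and> 1 < \<bar>\<mu> (E - E')\<bar>"
      if "E \<in> sets borel \<and> emeasure ?U E = \<infinity>" for E :: "'g set"
      using split[of E] that by simp
  qed
  then obtain E where E: "\<And>n. E n \<in> sets borel" "\<And>n. E (Suc n) \<subseteq> E n" "\<And>n. 1 < \<bar>\<mu> (E n - E (Suc n))\<bar>"
    by blast
  have anti: "E n \<subseteq> E k" if "k \<le> n" for k n
    by (rule lift_Suc_antimono_le[of E, OF E(2) that])
  have "disjoint_family (\<lambda>n. E n - E (Suc n))"
    unfolding disjoint_family_on_def
  proof (intro ballI impI)
    fix i j :: nat assume "i \<noteq> j"
    then show "(E i - E (Suc i)) \<inter> (E j - E (Suc j)) = {}"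
      using anti[of "Suc i" j] anti[of "Suc j" i] by (cases "i < j") auto
  qed
  moreover have "range (\<lambda>n. E n - E (Suc n)) \<subseteq> sets borel" using E(1) by auto
  ultimately have "(\<lambda>n. \<mu> (E n - E (Suc n))) sums \<mu> (\<Union>n. E n - E (Suc n))"
    by (intro vector_measureD[OF \<mu>])
  then have "summable (\<lambda>n. \<mu> (E n - E (Suc n)))" by (rule sums_summable)
  then have "(\<lambda>n. \<mu> (E n - E (Suc n))) \<longlonglongrightarrow> 0" by (rule summable_LIMSEQ_zero)
  then have "eventually (\<lambda>n. dist (\<mu> (E n - E (Suc n))) 0 < 1) sequentially" by (rule tendstoD) simp
  then obtain n where "dist (\<mu> (E n - E (Suc n))) 0 < 1" by (auto simp: eventually_sequentially)
  with E(3)[of n] show False by simp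
qed

end

locale finite_borel_measure = finite_measure m for m :: "'g::topological_space measure" +
  assumes sets_borel[measurable_cong]: "sets m = sets borel"
begin

lemma space_UNIV: "space m = UNIV"
  using sets_eq_imp_space_eq[OF sets_borel] by simp

text \<open>
The Jordan decomposition \<open>\<mu> = \<mu>\<^sup>+ - \<mu>\<^sup>-\<close> into upper variations, each of which is absolutely
continuous and finite. One half of the decomposition formula implies the other by passing to \<open>- \<mu>\<close>.
\<close>

lemma real_density_exists:
  fixes \<mu> :: "'g set \<Rightarrow> real"
  assumes \<mu>: "vector_measure \<mu>" and null: "\<And>A. A \<in> sets borel \<Longrightarrow> measure m A = 0 \<Longrightarrow> \<mu> A = 0"
  shows "\<exists>h. integrable m h \<and> (\<forall>A\<in>sets borel. \<mu> A = (LINT t:A|m. h t))"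
proof -
  have dens: "\<exists>p. integrable m p \<and> (\<forall>A\<in>sets borel. measure (upper_variation \<mu>) A = (LINT t:A|m. p t))"
    if \<mu>: "vector_measure \<mu>" and null: "\<And>A. A \<in> sets borel \<Longrightarrow> measure m A = 0 \<Longrightarrow> \<mu> A = 0"
    for \<mu> :: "'g set \<Rightarrow> real"
  proof -
    let ?U = "upper_variation \<mu>"
    interpret U: finite_measure ?U by (rule finite_upper_variation[OF \<mu>])
    have [simp]: "sets ?U = sets m" using sets_upper_variation[OF \<mu>] by (simp add: sets_borel)
    have ac: "absolutely_continuous m ?U"
      unfolding absolutely_continuous_def
    proof
      fix A assume A: "A \<in> null_sets m"
      then have A': "A \<in> sets borel" by (auto simp: sets_borel[symmetric])
      have "\<mu> F = 0" if "F \<in> sets borel" "F \<subseteq> A" for F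
        using emeasure_mono[of F A m] A A' that null[of F] by (auto simp: sets_borel measure_def)
      then have "emeasure ?U A \<le> 0"
        unfolding emeasure_upper_variation[OF \<mu> A'] by (intro SUP_least) auto
      then show "A \<in> null_sets ?U" using A' by (simp add: null_sets_def sets_borel)
    qed
    obtain p where p: "p \<in> borel_measurable m" "AE t in m. RN_deriv m ?U t = ennreal (p t)" "\<And>t. 0 \<le> p t"
      using real_RN_deriv[OF U.finite_measure_axioms ac] by auto
    note [measurable] = p(1)
    have "?U = density m (RN_deriv m ?U)" using density_RN_deriv[OF ac] by simp
    also have "\<dots> = density m (\<lambda>t. ennreal (p t))" using p by (intro density_cong) auto
    finally have U: "?U = density m (\<lambda>t. ennreal (p t))" .
    have em: "emeasure ?U A = (\<integral>\<^sup>+t\<in>A. ennreal (p t) \<partial>m)" if "A \<in> sets borel" for A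
      using that p(1) by (subst U) (simp add: emeasure_density sets_borel)
    have int: "integrable m p"
    proof (rule integrableI_bounded)
      have "(\<integral>\<^sup>+t. ennreal (norm (p t)) \<partial>m) = emeasure ?U UNIV" using em[of UNIV] p(3) by simp
      then show "(\<integral>\<^sup>+t. ennreal (norm (p t)) \<partial>m) < \<infinity>"
        by (simp add: less_top[symmetric])
    qed fact
    moreover have "measure ?U A = (LINT t:A|m. p t)" if A: "A \<in> sets borel" for A
    proof -
      have "emeasure ?U A = (\<integral>\<^sup>+t. ennreal (indicator A t * p t) \<partial>m)"
        unfolding em[OF A] by (intro nn_integral_cong) (auto split: split_indicator)
      also have "\<dots> = ennreal (\<integral>t. indicator A t * p t \<partial>m)"
        using p(3) A integrable_mult_indicator[OF _ int, of A] by (intro nn_integral_eq_integral) (auto simp: sets_borel)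
      finally show ?thesis
        by (simp add: measure_def set_lebesgue_integral_def p(3))
    qed
    ultimately show ?thesis by blast
  qed
  have \<mu>': "vector_measure (\<lambda>A. - \<mu> A)"
    using vector_measure_compose[OF bounded_linear_minus[OF bounded_linear_ident] \<mu>] .
  obtain p where p: "integrable m p" "\<And>A. A \<in> sets borel \<Longrightarrow> measure (upper_variation \<mu>) A = (LINT t:A|m. p t)"
    using dens[OF \<mu> null] by blast
  obtain q where q: "integrable m q"
    "\<And>A. A \<in> sets borel \<Longrightarrow> measure (upper_variation (\<lambda>A. - \<mu> A)) A = (LINT t:A|m. q t)"
    using dens[OF \<mu>'] null by auto
  have "\<mu> A = (LINT t:A|m. p t - q t)" if A: "A \<in> sets borel" for A
  proof -
    have jordan: "\<mu> A \<le> measure (upper_variation \<mu>) A - measure (upper_variation (\<lambda>A. - \<mu> A)) A"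
      if \<mu>: "vector_measure \<mu>" for \<mu> :: "'g set \<Rightarrow> real"
    proof -
      let ?U = "upper_variation \<mu>" and ?V = "upper_variation (\<lambda>A. - \<mu> A)"
      have \<mu>': "vector_measure (\<lambda>A. - \<mu> A)"
        using vector_measure_compose[OF bounded_linear_minus[OF bounded_linear_ident] \<mu>] .
      interpret U: finite_measure ?U by (rule finite_upper_variation[OF \<mu>])
      interpret V: finite_measure ?V by (rule finite_upper_variation[OF \<mu>'])
      have "- \<mu> F \<le> measure ?U A - \<mu> A" if F: "F \<in> sets borel" "F \<subseteq> A" for F
      proof -
        have "ennreal (\<mu> (A - F)) \<le> emeasure ?U A"
          unfolding emeasure_upper_variation[OF \<mu> A] using A F by (intro SUP_upper) auto
        then have "\<mu> (A - F) \<le> measure ?U A"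
          by (simp add: U.emeasure_eq_measure)
        then show ?thesis using vector_measure_Diff[OF \<mu> F(1) A F(2)] by simp
      qed
      then have "(SUP F\<in>{F\<in>sets borel. F \<subseteq> A}. ennreal (- \<mu> F)) \<le> ennreal (measure ?U A - \<mu> A)"
        by (intro SUP_least ennreal_leI) auto
      then have "ennreal (measure ?V A) \<le> ennreal (measure ?U A - \<mu> A)"
        using emeasure_upper_variation[OF \<mu>' A] by (simp add: V.emeasure_eq_measure)
      moreover have "0 \<le> measure ?U A - \<mu> A"
      proof -
        have "ennreal (\<mu> A) \<le> emeasure ?U A"
          unfolding emeasure_upper_variation[OF \<mu> A] using A by (intro SUP_upper) auto
        then show ?thesis by (simp add: U.emeasure_eq_measure)
      qed
      ultimately show ?thesis by simp
    qed
    have "\<mu> A = measure (upper_variation \<mu>) A - measure (upper_variation (\<lambda>A. - \<mu> A)) A"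
      using jordan[OF \<mu>] jordan[OF \<mu>'] by simp
    also have "\<dots> = (LINT t:A|m. p t - q t)"
      using A p q integrable_mult_indicator[of A m p] integrable_mult_indicator[of A m q]
      by (subst set_integral_diff) (auto simp: set_integrable_def sets_borel)
    finally show ?thesis .
  qed
  moreover have "integrable m (\<lambda>t. p t - q t)" using p q by simp
  ultimately show ?thesis by blast
qed

lemma complex_density:
  fixes \<mu> :: "'g set \<Rightarrow> complex"
  assumes \<mu>: "vector_measure \<mu>" and null: "\<And>A. A \<in> sets borel \<Longrightarrow> measure m A = 0 \<Longrightarrow> \<mu> A = 0"
  shows "integrable m (density_of m \<mu>)"
    "A \<in> sets borel \<Longrightarrow> \<mu> A = (LINT t:A|m. density_of m \<mu> t)"
proof -
  obtain p where p: "integrable m p" "\<And>A. A \<in> sets borel \<Longrightarrow> Re (\<mu> A) = (LINT t:A|m. p t)"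
    using real_density_exists[OF vector_measure_compose[OF bounded_linear_Re \<mu>]] null by auto
  obtain q where q: "integrable m q" "\<And>A. A \<in> sets borel \<Longrightarrow> Im (\<mu> A) = (LINT t:A|m. q t)"
    using real_density_exists[OF vector_measure_compose[OF bounded_linear_Im \<mu>]] null by auto
  have "\<exists>h. integrable m h \<and> (\<forall>A\<in>sets borel. \<mu> A = (LINT t:A|m. h t))"
  proof (intro exI conjI ballI)
    show "integrable m (\<lambda>t. of_real (p t) + \<i> * of_real (q t))" using p q by simp
    fix A :: "'g set" assume A: "A \<in> sets borel"
    then have i: "set_integrable m A (\<lambda>t. complex_of_real (p t))" "set_integrable m A (\<lambda>t. complex_of_real (q t))"
      using p q integrable_mult_indicator[of A m "\<lambda>t. complex_of_real (p t)"]
        integrable_mult_indicator[of A m "\<lambda>t. complex_of_real (q t)"]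
      by (simp_all add: set_integrable_def sets_borel)
    show "\<mu> A = (LINT t:A|m. of_real (p t) + \<i> * of_real (q t))"
      using i A by (subst set_integral_add) (auto simp: set_integral_complex_of_real complex_eq_iff p(2) q(2))
  qed
  then have "integrable m (density_of m \<mu>) \<and> (\<forall>A\<in>sets borel. \<mu> A = (LINT t:A|m. density_of m \<mu> t))"
    unfolding density_of_def by (rule someI_ex)
  then show "integrable m (density_of m \<mu>)"
    "A \<in> sets borel \<Longrightarrow> \<mu> A = (LINT t:A|m. density_of m \<mu> t)" by auto
qed

text \<open>
The supremum of \<open>\<mu>\<close> over the Borel subsets of \<open>E\<close> is attained at \<open>E \<inter> {h > 0}\<close>.
\<close>

lemma upper_variation_density:
  fixes h :: "'g \<Rightarrow> real"
  assumes h: "integrable m h" and \<mu>: "\<And>A. A \<in> sets borel \<Longrightarrow> \<mu> A = (LINT t:A|m. h t)"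
  shows "upper_variation \<mu> = density m (\<lambda>t. max 0 (h t))"
  unfolding upper_variation_def
proof (rule measure_of_borel_eqI)
  note [measurable] = borel_measurable_integrable[OF h]
  show "sets (density m (\<lambda>t. ennreal (max 0 (h t)))) = sets borel" by (simp add: sets_borel)
  fix E :: "'g set" assume E: "E \<in> sets borel"
  have le: "\<mu> F \<le> (LINT t:E|m. max 0 (h t))" if F: "F \<in> sets borel" "F \<subseteq> E" for F
  proof -
    have "(LINT t:F|m. h t) \<le> (LINT t:E|m. max 0 (h t))"
      unfolding set_lebesgue_integral_def
      by (intro integral_mono integrable_mult_indicator h integrable_max)
         (use E F in \<open>auto simp: sets_borel split: split_indicator\<close>)
    then show ?thesis by (simp add: \<mu> F)
  qed
  have E': "E \<inter> {t. 0 < h t} \<in> sets borel"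
  proof -
    have "{t. 0 < h t} = {t \<in> space m. 0 < h t}" by (simp add: space_UNIV)
    also have "\<dots> \<in> sets m" by measurable
    finally show ?thesis using E by (auto simp: sets_borel)
  qed
  have eq: "\<mu> (E \<inter> {t. 0 < h t}) = (LINT t:E|m. max 0 (h t))"
    unfolding \<mu>[OF E'] set_lebesgue_integral_def
    by (intro Bochner_Integration.integral_cong) (auto split: split_indicator)
  have "(SUP F\<in>{F\<in>sets borel. F \<subseteq> E}. ennreal (\<mu> F)) = ennreal (LINT t:E|m. max 0 (h t))"
  proof (rule antisym)
    show "(SUP F\<in>{F\<in>sets borel. F \<subseteq> E}. ennreal (\<mu> F)) \<le> ennreal (LINT t:E|m. max 0 (h t))"
      by (intro SUP_least ennreal_leI le) auto
    show "ennreal (LINT t:E|m. max 0 (h t)) \<le> (SUP F\<in>{F\<in>sets borel. F \<subseteq> E}. ennreal (\<mu> F))"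
      unfolding eq[symmetric] using E' by (intro SUP_upper) auto
  qed
  also have "\<dots> = (\<integral>\<^sup>+t. ennreal (indicator E t *\<^sub>R max 0 (h t)) \<partial>m)"
    unfolding set_lebesgue_integral_def
    by (intro nn_integral_eq_integral[symmetric] integrable_mult_indicator integrable_max h) (use E in \<open>auto simp: sets_borel\<close>)
  also have "\<dots> = emeasure (density m (\<lambda>t. max 0 (h t))) E"
    using E by (subst emeasure_density) (auto simp: sets_borel intro!: nn_integral_cong split: split_indicator)
  finally show "(SUP F\<in>{F\<in>sets borel. F \<subseteq> E}. ennreal (\<mu> F)) = emeasure (density m (\<lambda>t. max 0 (h t))) E" .
qed

lemma cm_integral_eq:
  fixes h u :: "'g \<Rightarrow> complex"
  assumes h: "integrable m h" and \<mu>: "\<And>A. A \<in> sets borel \<Longrightarrow> \<mu> A = (LINT t:A|m. h t)"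
    and u[measurable]: "u \<in> borel_measurable borel" and uh: "integrable m (\<lambda>t. u t * h t)"
  shows "cm_integral \<mu> u = (LINT t|m. u t * h t)"
proof -
  note hm[measurable] = borel_measurable_integrable[OF h]
  have si: "set_integrable m A h" if "A \<in> sets borel" for A
    using that integrable_mult_indicator[OF _ h] by (auto simp: set_integrable_def sets_borel)
  have ReT: "T (\<mu> A) = (LINT t:A|m. T (h t))" if "A \<in> sets borel" "bounded_linear T" for A and T :: "complex \<Rightarrow> real"
    using that si[OF that(1)] integral_bounded_linear[OF that(2), of m "\<lambda>t. indicator A t *\<^sub>R h t"]
    by (simp add: \<mu> set_lebesgue_integral_def set_integrable_def linear_simps bounded_linear.linear linear_cmul)
  have part: "integrable m (\<lambda>t. max 0 (T (h t)) *\<^sub>R u t)"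
    "integral\<^sup>L (upper_variation (\<lambda>A. T (\<mu> A))) u = (LINT t|m. max 0 (T (h t)) *\<^sub>R u t)"
    if T: "bounded_linear T" and T1: "\<And>z. \<bar>T z\<bar> \<le> cmod z" for T :: "complex \<Rightarrow> real"
  proof -
    have "integrable m (\<lambda>t. T (h t))" by (rule integrable_bounded_linear[OF T h])
    then have m: "(\<lambda>t. T (h t)) \<in> borel_measurable m" by simp
    note [measurable] = this
    show "integrable m (\<lambda>t. max 0 (T (h t)) *\<^sub>R u t)"
    proof (rule Bochner_Integration.integrable_bound[OF uh])
      show "AE t in m. norm (max 0 (T (h t)) *\<^sub>R u t) \<le> norm (u t * h t)"
      proof (rule AE_I2)
        fix t
        have "max 0 (T (h t)) \<le> cmod (h t)" using T1[of "h t"] by auto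
        then show "norm (max 0 (T (h t)) *\<^sub>R u t) \<le> norm (u t * h t)"
          by (simp add: norm_mult mult.commute[of "cmod (u t)"] mult_right_mono)
      qed
    qed measurable
    have "upper_variation (\<lambda>A. T (\<mu> A)) = density m (\<lambda>t. max 0 (T (h t)))"
      using ReT[OF _ T] by (intro upper_variation_density \<open>integrable m (\<lambda>t. T (h t))\<close>)
    then show "integral\<^sup>L (upper_variation (\<lambda>A. T (\<mu> A))) u = (LINT t|m. max 0 (T (h t)) *\<^sub>R u t)"
      by (simp add: integral_density)
  qed
  have T: "bounded_linear Re" "bounded_linear (\<lambda>z. - Re z)" "bounded_linear Im" "bounded_linear (\<lambda>z. - Im z)"
    by (intro bounded_linear_Re bounded_linear_Im bounded_linear_minus)+
  have T1: "\<bar>Re z\<bar> \<le> cmod z" "\<bar>- Re z\<bar> \<le> cmod z" "\<bar>Im z\<bar> \<le> cmod z" "\<bar>- Im z\<bar> \<le> cmod z" for z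
    by (auto simp: abs_Re_le_cmod abs_Im_le_cmod)
  note P = part[OF T(1) T1(1)] part[OF T(2) T1(2)] part[OF T(3) T1(3)] part[OF T(4) T1(4)]
  have "u t * h t = (max 0 (Re (h t)) *\<^sub>R u t - max 0 (- Re (h t)) *\<^sub>R u t)
      + \<i> * (max 0 (Im (h t)) *\<^sub>R u t - max 0 (- Im (h t)) *\<^sub>R u t)" for t
    by (auto simp: complex_eq_iff max_def algebra_simps)
  then have "(LINT t|m. u t * h t) = (LINT t|m. (max 0 (Re (h t)) *\<^sub>R u t - max 0 (- Re (h t)) *\<^sub>R u t)
      + \<i> * (max 0 (Im (h t)) *\<^sub>R u t - max 0 (- Im (h t)) *\<^sub>R u t))" by simp
  also have "\<dots> = cm_integral \<mu> u"
    unfolding cm_integral_def P(2,4,6,8)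
    by (simp only: Bochner_Integration.integral_add Bochner_Integration.integral_diff integral_mult_right_zero
      Bochner_Integration.integrable_diff integrable_mult_right P)
  finally show ?thesis by simp
qed

end

text \<open>
Real and imaginary parts are rounded down to multiples of a small \<open>1 / n\<close>; boundedness leaves
finitely many values.
\<close>

lemma uniform_simple_approximation:
  fixes \<phi> :: "'g::topological_space \<Rightarrow> complex"
  assumes [measurable]: "\<phi> \<in> borel_measurable borel" and B: "\<And>t. cmod (\<phi> t) \<le> B" and \<epsilon>: "0 < \<epsilon>"
  obtains s where "s \<in> borel_measurable borel" "finite (range s)" "\<And>t. cmod (s t - \<phi> t) \<le> \<epsilon>"
proof -
  obtain n :: nat where n: "2 / \<epsilon> < real n" using reals_Archimedean2 by blast
  with \<epsilon> have n0: "0 < real n" by (smt (verit) divide_pos_pos)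
  define r where "r x = of_int \<lfloor>real n * x\<rfloor> / real n" for x
  have r: "\<bar>r x - x\<bar> \<le> 1 / real n" for x
  proof -
    have "\<bar>of_int \<lfloor>real n * x\<rfloor> - real n * x\<bar> \<le> 1" by linarith
    then have "\<bar>of_int \<lfloor>real n * x\<rfloor> - real n * x\<bar> / real n \<le> 1 / real n"
      using n0 by (intro divide_right_mono) auto
    also have "\<bar>of_int \<lfloor>real n * x\<rfloor> - real n * x\<bar> / real n = \<bar>r x - x\<bar>"
      using n0 by (simp add: r_def field_simps flip: abs_divide)
    finally show ?thesis .
  qed
  have fin: "finite (r ` {- B..B})"
  proof -
    have "r ` {- B..B} \<subseteq> (\<lambda>k. of_int k / real n) ` {\<lfloor>real n * - B\<rfloor>..\<lfloor>real n * B\<rfloor>}"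
    proof
      fix y assume "y \<in> r ` {- B..B}"
      then obtain x where x: "y = r x" "- B \<le> x" "x \<le> B" by auto
      have "\<lfloor>real n * x\<rfloor> \<in> {\<lfloor>real n * - B\<rfloor>..\<lfloor>real n * B\<rfloor>}"
        using x(2,3) unfolding atLeastAtMost_iff by (intro conjI floor_mono mult_left_mono) auto
      then show "y \<in> (\<lambda>k. of_int k / real n) ` {\<lfloor>real n * - B\<rfloor>..\<lfloor>real n * B\<rfloor>}"
        unfolding x(1) r_def by (rule imageI)
    qed
    then show ?thesis by (rule finite_subset) simp
  qed
  define s where "s t = Complex (r (Re (\<phi> t))) (r (Im (\<phi> t)))" for t
  have "s \<in> borel_measurable borel"
    unfolding s_def r_def Complex_eq by measurable
  moreover have "finite (range s)"
  proof -
    have "Re (\<phi> t) \<in> {- B..B}" "Im (\<phi> t) \<in> {- B..B}" for t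
      using abs_Re_le_cmod[of "\<phi> t"] abs_Im_le_cmod[of "\<phi> t"] B[of t] by auto
    then have "range s \<subseteq> (\<lambda>(a, b). Complex a b) ` (r ` {- B..B} \<times> r ` {- B..B})"
      unfolding s_def by (auto intro!: image_eqI[where x = "(r a, r b)" for a b])
    then show ?thesis by (rule finite_subset) (use fin in auto)
  qed
  moreover have "cmod (s t - \<phi> t) \<le> \<epsilon>" for t
  proof -
    have "cmod (s t - \<phi> t) \<le> \<bar>Re (s t - \<phi> t)\<bar> + \<bar>Im (s t - \<phi> t)\<bar>" by (rule cmod_le)
    also have "\<dots> \<le> 1 / real n + 1 / real n" unfolding s_def by (intro add_mono) (auto simp: r)
    also have "\<dots> \<le> \<epsilon>" using n n0 \<epsilon> by (simp add: field_simps)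
    finally show ?thesis .
  qed
  ultimately show thesis using that by blast
qed

lemma finite_range_representation:
  fixes s :: "'g \<Rightarrow> complex"
  assumes "finite (range s)"
  shows "s t = (\<Sum>y\<in>range s. indicator (s -` {y}) t * y)"
proof -
  have "(\<Sum>y\<in>range s. indicator (s -` {y}) t * y) = (\<Sum>y\<in>range s. if y = s t then y else 0)"
    by (intro sum.cong) (auto split: split_indicator)
  also have "\<dots> = s t" using assms by (simp add: sum.delta)
  finally show ?thesis by simp
qed

text \<open>
The bound of the total variation of \<open>E\<close> by \<open>\<integral>\<^sub>E \<bar>h\<bar>\<close> is the triangle inequality. Conversely \<open>\<bar>h\<bar> = w h\<close> with
\<open>w = cnj (sgn h)\<close> of modulus at most 1. A simple function \<open>s\<close> uniformly close to \<open>w\<close> cuts \<open>E\<close> into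
finitely many sets \<open>B\<^sub>y\<close>, on which \<open>s\<close> is a constant \<open>y\<close> of modulus at most \<open>1 + \<epsilon>\<close>; so
\<open>\<integral>\<^sub>E s h = \<Sum> y \<mu> B\<^sub>y\<close> is at most \<open>(1 + \<epsilon>)\<close> times the total variation, and close to \<open>\<integral>\<^sub>E \<bar>h\<bar>\<close>.
\<close>

lemma (in finite_borel_measure) total_variation_density:
  fixes h :: "'g \<Rightarrow> complex"
  assumes h: "integrable m h" and \<mu>: "\<And>A. A \<in> sets borel \<Longrightarrow> \<mu> A = (LINT t:A|m. h t)"
  shows "total_variation \<mu> = density m (\<lambda>t. cmod (h t))"
  unfolding total_variation_def
proof (rule measure_of_borel_eqI)
  note hm[measurable] = borel_measurable_integrable[OF h]
  show "sets (density m (\<lambda>t. ennreal (cmod (h t)))) = sets borel" by (simp add: sets_borel)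
  fix E :: "'g set" assume E: "E \<in> sets borel"
  let ?PP = "{P. finite P \<and> disjoint P \<and> P \<subseteq> sets borel \<and> \<Union>P = E}"
  define TV where "TV = (SUP P\<in>?PP. \<Sum>B\<in>P. ennreal (cmod (\<mu> B)))"
  define I where "I = (LINT t:E|m. cmod (h t))"
  have si: "set_integrable m A h" "set_integrable m A (\<lambda>t. cmod (h t))" if "A \<in> sets borel" for A
    using that integrable_mult_indicator[OF _ h] integrable_mult_indicator[OF _ integrable_norm[OF h]]
    by (auto simp: set_integrable_def sets_borel)
  have norm_le: "cmod (\<mu> B) \<le> (LINT t:B|m. cmod (h t))" if "B \<in> sets borel" for B
    using integral_norm_bound[of m "\<lambda>t. indicator B t *\<^sub>R h t"]
    by (simp add: \<mu>[OF that] set_lebesgue_integral_def)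
  have "TV \<le> ennreal I"
    unfolding TV_def
  proof (rule SUP_least)
    fix P assume "P \<in> ?PP"
    then have P: "finite P" "disjoint P" "P \<subseteq> sets borel" "\<Union>P = E" by auto
    have "(\<Sum>B\<in>P. cmod (\<mu> B)) \<le> (\<Sum>B\<in>P. LINT t:B|m. cmod (h t))"
      using P by (intro sum_mono norm_le) auto
    also have "\<dots> = (LINT t:(\<Union>B\<in>P. B)|m. cmod (h t))"
      using P si(2) by (intro set_integral_finite_Union[symmetric]) 
        (auto simp: sets_borel disjoint_family_on_def disjoint_def)
    also have "\<dots> = I" using P(4) by (simp add: I_def)
    finally show "(\<Sum>B\<in>P. ennreal (cmod (\<mu> B))) \<le> ennreal I"
      by (simp add: ennreal_leI)
  qed
  then have fin: "TV < \<infinity>" by (simp add: le_less_trans)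
  define R where "R = enn2real TV"
  have TV: "TV = ennreal R" using fin by (simp add: R_def)
  have R0: "0 \<le> R" by (simp add: R_def)
  have sum_le: "(\<Sum>B\<in>P. cmod (\<mu> B)) \<le> R" if "P \<in> ?PP" for P
  proof -
    have "ennreal (\<Sum>B\<in>P. cmod (\<mu> B)) \<le> TV"
      using SUP_upper[OF that, of "\<lambda>P. \<Sum>B\<in>P. ennreal (cmod (\<mu> B))"] by (simp add: TV_def)
    then show ?thesis by (simp add: TV R0)
  qed
  have "I \<le> R"
  proof (rule field_le_epsilon)
    fix e :: real assume e: "0 < e"
    define J where "J = (LINT t:E|m. cmod (h t))"
    have J0: "0 \<le> J" unfolding J_def set_lebesgue_integral_def by (intro integral_nonneg_AE) auto
    define \<epsilon> where "\<epsilon> = e / (R + J + 1)"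
    have \<epsilon>: "0 < \<epsilon>" "\<epsilon> * (R + J) \<le> e" using e R0 J0 by (auto simp: \<epsilon>_def field_simps)
    define w where "w t = cnj (sgn (h t))" for t
    have w1: "cmod (w t) \<le> 1" for t by (simp add: w_def norm_sgn)
    have [measurable]: "w \<in> borel_measurable borel"
    proof -
      have [measurable]: "cnj \<in> borel_measurable borel"
        by (intro borel_measurable_continuous_onI continuous_intros)
      have "w \<in> borel_measurable m" unfolding w_def sgn_div_norm by measurable
      then show ?thesis by (simp add: measurable_cong_sets[OF sets_borel refl])
    qed
    obtain s where s[measurable]: "s \<in> borel_measurable borel" and fins: "finite (range s)"
      and approx: "\<And>t. cmod (s t - w t) \<le> \<epsilon>"
      using uniform_simple_approximation[of w 1 \<epsilon>] w1 \<epsilon>(1) by auto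
    define Bs where "Bs y = E \<inter> s -` {y}" for y
    have Bs: "Bs y \<in> sets borel" for y
      using E measurable_sets[OF s, of "{y}"] by (auto simp: Bs_def)
    have BsE: "Bs y \<subseteq> E" for y by (auto simp: Bs_def)
    have disj: "disjoint_family_on Bs (range s)" by (auto simp: disjoint_family_on_def Bs_def)
    have UnBs: "(\<Union>y\<in>range s. Bs y) = E" by (auto simp: Bs_def)
    have sb: "cmod (s t) \<le> 1 + \<epsilon>" for t
      using norm_triangle_ineq[of "w t" "s t - w t"] approx[of t] w1[of t] by simp
    have part: "Bs ` range s \<in> ?PP"
      using fins Bs UnBs disjoint_family_on_disjoint_image[OF disj] by auto
    have sumB: "(\<Sum>y\<in>range s. cmod (\<mu> (Bs y))) \<le> R"
    proof -
      have "(\<Sum>y\<in>range s. cmod (\<mu> (Bs y))) = (\<Sum>B\<in>Bs ` range s. cmod (\<mu> B))"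
      proof (rule sum.reindex_nontrivial[OF fins, symmetric, unfolded o_def])
        fix y z assume "y \<in> range s" "z \<in> range s" "y \<noteq> z" "Bs y = Bs z"
        then have "Bs y = {}" using disj by (auto simp: disjoint_family_on_def)
        then show "cmod (\<mu> (Bs y)) = 0" using \<mu>[of "{}"] by (simp add: set_lebesgue_integral_def)
      qed
      also have "\<dots> \<le> R" by (rule sum_le[OF part])
      finally show ?thesis .
    qed
    have ish: "set_integrable m E (\<lambda>t. s t * h t)"
    proof -
      have "integrable m (\<lambda>t. s t * h t)"
      proof (rule Bochner_Integration.integrable_bound[OF integrable_mult_right[OF h, of "of_real (1 + \<epsilon>)"]])
        show "AE t in m. norm (s t * h t) \<le> norm (of_real (1 + \<epsilon>) * h t)"
          using sb \<epsilon>(1) by (auto simp: norm_mult simp del: of_real_add intro!: AE_I2 mult_right_mono)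
      qed measurable
      then show ?thesis using E integrable_mult_indicator[of E m] by (auto simp: set_integrable_def sets_borel)
    qed
    have "cmod (LINT t:E|m. s t * h t) \<le> (1 + \<epsilon>) * R"
    proof -
      have "(LINT t:E|m. s t * h t) = (LINT t:(\<Union>y\<in>range s. Bs y)|m. s t * h t)" by (simp only: UnBs)
      also have "\<dots> = (\<Sum>y\<in>range s. LINT t:Bs y|m. s t * h t)"
        using fins disj Bs
        by (intro set_integral_finite_Union) (auto simp: sets_borel intro: set_integrable_subset[OF ish _ BsE])
      also have "\<dots> = (\<Sum>y\<in>range s. y * \<mu> (Bs y))"
      proof (rule sum.cong[OF refl])
        fix y
        have "(LINT t:Bs y|m. s t * h t) = (LINT t:Bs y|m. y * h t)"
          by (rule set_lebesgue_integral_cong) (use Bs in \<open>auto simp: Bs_def sets_borel\<close>)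
        then show "(LINT t:Bs y|m. s t * h t) = y * \<mu> (Bs y)" by (simp add: \<mu>[OF Bs])
      qed
      also have "cmod \<dots> \<le> (\<Sum>y\<in>range s. (1 + \<epsilon>) * cmod (\<mu> (Bs y)))"
        using sb by (intro sum_norm_le) (auto simp: norm_mult intro!: mult_right_mono)
      also have "\<dots> \<le> (1 + \<epsilon>) * R"
        unfolding sum_distrib_left[symmetric] using sumB \<epsilon>(1) by (intro mult_left_mono) auto
      finally show ?thesis .
    qed
    moreover have "J \<le> cmod (LINT t:E|m. s t * h t) + \<epsilon> * J"
    proof -
      have "J - Re (LINT t:E|m. s t * h t) = (LINT t:E|m. cmod (h t) - Re (s t * h t))"
        using ish si(2)[OF E] integral_bounded_linear[OF bounded_linear_Re, of m "\<lambda>t. indicator E t *\<^sub>R (s t * h t)"]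
          integrable_bounded_linear[OF bounded_linear_Re, of m "\<lambda>t. indicator E t *\<^sub>R (s t * h t)"]
        by (subst set_integral_diff) (auto simp: J_def set_integrable_def set_lebesgue_integral_def)
      also have "\<dots> \<le> (LINT t:E|m. \<epsilon> * cmod (h t))"
      proof (rule set_integral_mono)
        show "set_integrable m E (\<lambda>t. cmod (h t) - Re (s t * h t))"
          using ish si(2)[OF E] integrable_bounded_linear[OF bounded_linear_Re, of m "\<lambda>t. indicator E t *\<^sub>R (s t * h t)"]
          by (intro set_integral_diff) (auto simp: set_integrable_def)
        show "set_integrable m E (\<lambda>t. \<epsilon> * cmod (h t))" using si(2)[OF E] by simp
        fix t
        have "w t * h t = cmod (h t)"
          using complex_norm_square[of "h t"]
          by (cases "h t = 0") (simp_all add: w_def sgn_eq mult.commute power2_eq_square field_simps)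
        then have "cmod (h t) - Re (s t * h t) = Re ((w t - s t) * h t)" by (simp add: algebra_simps)
        also have "\<dots> \<le> cmod ((w t - s t) * h t)" by (rule complex_Re_le_cmod)
        also have "\<dots> \<le> \<epsilon> * cmod (h t)"
          using approx[of t] by (simp add: norm_mult norm_minus_commute mult_right_mono)
        finally show "cmod (h t) - Re (s t * h t) \<le> \<epsilon> * cmod (h t)" .
      qed
      also have "\<dots> = \<epsilon> * J" by (simp add: J_def)
      finally show ?thesis using complex_Re_le_cmod[of "LINT t:E|m. s t * h t"] by simp
    qed
    ultimately have "J \<le> R + \<epsilon> * (R + J)" by (simp add: algebra_simps)
    with \<epsilon>(2) show "I \<le> R + e" by (simp add: I_def J_def)
  qed
  with \<open>TV \<le> ennreal I\<close> have "TV = ennreal I" by (simp add: TV R0 antisym ennreal_leI)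
  also have "\<dots> = (\<integral>\<^sup>+t. ennreal (indicator E t *\<^sub>R cmod (h t)) \<partial>m)"
    unfolding I_def set_lebesgue_integral_def
    using si(2)[OF E] by (intro nn_integral_eq_integral[symmetric]) (auto simp: set_integrable_def)
  also have "\<dots> = emeasure (density m (\<lambda>t. cmod (h t))) E"
    using E by (subst emeasure_density) (auto simp: sets_borel intro!: nn_integral_cong split: split_indicator)
  finally show "(SUP P\<in>?PP. \<Sum>B\<in>P. ennreal (cmod (\<mu> B))) = emeasure (density m (\<lambda>t. cmod (h t))) E"
    by (simp add: TV_def)
qed

section \<open>Integrals of bounded multiples of an integrable function\<close>

lemma (in finite_borel_measure) scalar_measure_density:
  fixes \<nu> :: "'g set \<Rightarrow> 'x::complex_normed_vector"
  assumes \<nu>: "\<nu> \<in> M_ac m" and x': "x' \<in> cdual"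
  shows "integrable m (density_of m (scalar_measure \<nu> x'))"
    "A \<in> sets borel \<Longrightarrow> scalar_measure \<nu> x' A = (LINT t:A|m. density_of m (scalar_measure \<nu> x') t)"
proof -
  have vm: "vector_measure (scalar_measure \<nu> x')"
    using \<nu> vector_measure_compose[OF cdualD(1)[OF x']] by (auto simp: M_ac_def scalar_measure_def)
  have null: "scalar_measure \<nu> x' A = 0" if A: "A \<in> sets borel" "measure m A = 0" for A
  proof -
    have "norm (\<nu> A) < \<epsilon>" if "0 < \<epsilon>" for \<epsilon>
      using \<nu> A that by (force simp: M_ac_def)
    then have "\<nu> A = 0" by (metis less_irrefl zero_less_norm_iff)
    then show ?thesis by (simp add: scalar_measure_def cdualD(5)[OF x'])
  qed
  show "integrable m (density_of m (scalar_measure \<nu> x'))"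
    "A \<in> sets borel \<Longrightarrow> scalar_measure \<nu> x' A = (LINT t:A|m. density_of m (scalar_measure \<nu> x') t)"
    using complex_density[OF vm null] by auto
qed

text \<open>
Weak integrability is a condition on total variations. Knowing these as the measures with
density \<open>\<bar>h\<bar>\<close> turns it into integrability with respect to \<open>m\<close>.
\<close>

lemma (in finite_borel_measure) L1_weak_density:
  fixes \<nu> :: "'g set \<Rightarrow> 'x::complex_normed_vector"
  assumes \<nu>: "\<nu> \<in> M_ac m" and f: "f \<in> L1_weak \<nu>" and x': "x' \<in> cdual"
  shows "f \<in> borel_measurable borel" "integrable m (\<lambda>t. f t * density_of m (scalar_measure \<nu> x') t)"
proof -
  let ?h = "density_of m (scalar_measure \<nu> x')"
  have h: "integrable m ?h" by (rule scalar_measure_density(1)[OF \<nu> x'])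
  note [measurable] = borel_measurable_integrable[OF h]
  have "total_variation (scalar_measure \<nu> x') = density m (\<lambda>t. cmod (?h t))"
    by (rule total_variation_density[OF h scalar_measure_density(2)[OF \<nu> x']])
  then have int: "integrable (density m (\<lambda>t. cmod (?h t))) f"
    using f x' by (auto simp: L1_weak_def)
  then have fm[measurable]: "f \<in> borel_measurable m" using borel_measurable_integrable by force
  then show "f \<in> borel_measurable borel" by (simp add: measurable_cong_sets[OF sets_borel refl])
  have "integrable m (\<lambda>t. cmod (?h t) *\<^sub>R f t)"
    using int by (subst (asm) integrable_density) auto
  then show "integrable m (\<lambda>t. f t * ?h t)"
    by (rule Bochner_Integration.integrable_bound) (auto simp: norm_mult)
qed

text \<open>
The step from simple to bounded \<open>\<phi>\<close> is where the norm of \<open>X\<close>, rather than its weak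
topology, matters: uniform boundedness makes the integrals of uniformly convergent simple
multipliers a Cauchy sequence.
\<close>

lemma (in finite_borel_measure) bounded_multiplier_integral:
  fixes \<nu> :: "'g set \<Rightarrow> 'x::{complex_normed_vector, complete_space}"
  assumes \<nu>: "\<nu> \<in> M_ac m" and f: "f \<in> L1 \<nu>"
    and \<phi>: "\<phi> \<in> borel_measurable borel" and B: "\<And>t. cmod (\<phi> t) \<le> B" and x': "x' \<in> cdual"
  shows "x' (vm_integral \<nu> UNIV (\<lambda>t. f t * \<phi> t)) =
    (LINT t|m. f t * \<phi> t * density_of m (scalar_measure \<nu> x') t)"
proof -
  define h where "h x' = density_of m (scalar_measure \<nu> x')" for x'
  have fw: "f \<in> L1_weak \<nu>" using f by (simp add: L1_def)
  have h: "integrable m (h x')" "\<And>A. A \<in> sets borel \<Longrightarrow> scalar_measure \<nu> x' A = (LINT t:A|m. h x' t)"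
    "integrable m (\<lambda>t. f t * h x' t)" if "x' \<in> cdual" for x'
    using scalar_measure_density[OF \<nu> that] L1_weak_density(2)[OF \<nu> fw that] by (auto simp: h_def)
  have fm[measurable]: "f \<in> borel_measurable borel" by (rule L1_weak_density(1)[OF \<nu> fw x'])
  have fh: "integrable m (\<lambda>t. f t * \<phi> t * h x' t)"
    "cmod (LINT t|m. f t * \<phi> t * h x' t) \<le> B * (LINT t|m. cmod (f t * h x' t))"
    if x': "x' \<in> cdual" and [measurable]: "\<phi> \<in> borel_measurable borel" and B: "\<And>t. cmod (\<phi> t) \<le> B" for x' \<phi> B
  proof -
    note [measurable] = borel_measurable_integrable[OF h(1)[OF x']]
    have le: "cmod (f t * \<phi> t * h x' t) \<le> B * cmod (f t * h x' t)" for t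
      using mult_right_mono[OF B[of t], of "cmod (f t * h x' t)"] by (simp add: norm_mult ac_simps)
    show int: "integrable m (\<lambda>t. f t * \<phi> t * h x' t)"
    proof (rule Bochner_Integration.integrable_bound)
      show "integrable m (\<lambda>t. B * cmod (f t * h x' t))"
        by (intro integrable_mult_right integrable_norm h(3) x')
      show "AE t in m. norm (f t * \<phi> t * h x' t) \<le> norm (B * cmod (f t * h x' t))"
        using le by (intro AE_I2) (metis abs_ge_self order_trans real_norm_def)
    qed measurable
    have "cmod (LINT t|m. f t * \<phi> t * h x' t) \<le> (LINT t|m. cmod (f t * \<phi> t * h x' t))"
      by (rule integral_norm_bound)
    also have "\<dots> \<le> (LINT t|m. B * cmod (f t * h x' t))"
      by (intro integral_mono integrable_norm int integrable_mult_right h(3) x' le)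
    finally show "cmod (LINT t|m. f t * \<phi> t * h x' t) \<le> B * (LINT t|m. cmod (f t * h x' t))" by simp
  qed
  define I where "I \<phi> x \<longleftrightarrow> (\<forall>x'\<in>cdual. x' x = (LINT t|m. f t * \<phi> t * h x' t))" for \<phi> and x :: 'x
  have vm: "is_vm_integral \<nu> UNIV (\<lambda>t. f t * \<phi> t) x \<longleftrightarrow> I \<phi> x"
    if [measurable]: "\<phi> \<in> borel_measurable borel" and B: "\<And>t. cmod (\<phi> t) \<le> B" for \<phi> B x
  proof -
    have "cm_integral (scalar_measure \<nu> x') (\<lambda>t. f t * \<phi> t) = (LINT t|m. f t * \<phi> t * h x' t)"
      if x': "x' \<in> cdual" for x'
      by (rule cm_integral_eq[OF h(1,2)[OF x']]) (use fh(1)[OF x' _ B] in auto)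
    then show ?thesis by (simp add: is_vm_integral_def I_def cm_set_integral_def)
  qed
  \<comment> \<open>If \<open>x'\<close> agrees on \<open>x\<close> and \<open>y\<close> for all \<open>x'\<close>, then adding \<open>x - y\<close> to the integral of \<open>f\<close> gives
    another integral of \<open>f\<close>; so uniqueness of the latter separates points.\<close>
  have separated: "x = y" if "\<And>x'. x' \<in> cdual \<Longrightarrow> x' x = x' y" for x y :: 'x
  proof -
    have "\<exists>!x. is_vm_integral \<nu> UNIV f x" using f by (auto simp: L1_def)
    moreover have "is_vm_integral \<nu> UNIV f (z + (x - y))" if "is_vm_integral \<nu> UNIV f z" for z
      using that \<open>\<And>x'. x' \<in> cdual \<Longrightarrow> x' x = x' y\<close> by (auto simp: is_vm_integral_def cdualD(2,4))
    ultimately show ?thesis by (metis add_cancel_left_right eq_iff_diff_eq_0)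
  qed
  have I_indicator: "\<exists>x. I (indicator A) x" if A: "A \<in> sets borel" for A
  proof -
    obtain x where x: "is_vm_integral \<nu> A f x" using f A by (auto simp: L1_def)
    have "x' x = (LINT t|m. f t * indicator A t * h x' t)" if x': "x' \<in> cdual" for x'
    proof -
      have [measurable]: "A \<in> sets borel" by fact
      have eq: "indicator A t *\<^sub>R f t = f t * indicator A t" for t by (simp split: split_indicator)
      have "x' x = cm_integral (scalar_measure \<nu> x') (\<lambda>t. f t * indicator A t)"
        using x x' by (simp add: is_vm_integral_def cm_set_integral_def eq)
      also have "\<dots> = (LINT t|m. f t * indicator A t * h x' t)"
        using fh(1)[OF x', of "indicator A" 1] A
        by (intro cm_integral_eq h x') (auto simp: indicator_def)
      finally show ?thesis .
    qed
    then show ?thesis by (auto simp: I_def)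
  qed
  have I_scale: "I (\<lambda>t. a * \<phi> t) (a *\<^sub>C x)" if "I \<phi> x" for a \<phi> x
    using that by (auto simp: I_def cdualD(3) mult.left_commute[of _ a] mult.assoc)
  have I_diff: "I (\<lambda>t. \<phi> t - \<psi> t) (x - y)"
    if "I \<phi> x" "I \<psi> y" "\<phi> \<in> borel_measurable borel" "\<psi> \<in> borel_measurable borel"
      "\<And>t. cmod (\<phi> t) \<le> B" "\<And>t. cmod (\<psi> t) \<le> C" for \<phi> \<psi> x y B C
    using that fh(1)[of _ \<phi> B] fh(1)[of _ \<psi> C]
    by (auto simp: I_def cdualD(4) left_diff_distrib right_diff_distrib)
  have I_simple: "\<exists>x. I s x" if s: "s \<in> borel_measurable borel" and fin: "finite (range s)" for s
  proof -
    have A: "s -` {y} \<in> sets borel" for y using measurable_sets[OF s, of "{y}"] by simp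
    have "\<exists>X. \<forall>y. I (indicator (s -` {y})) (X y)" using I_indicator[OF A] by (intro choice) blast
    then obtain X where X: "\<And>y. I (indicator (s -` {y})) (X y)" by blast
    have "x' (\<Sum>y\<in>range s. y *\<^sub>C X y) = (LINT t|m. f t * s t * h x' t)" if x': "x' \<in> cdual" for x'
    proof -
      have int: "integrable m (\<lambda>t. f t * indicator (s -` {y}) t * h x' t)" for y
        by (intro fh(1)[OF x', of _ 1] borel_measurable_indicator A) (simp split: split_indicator)
      have "x' (\<Sum>y\<in>range s. y *\<^sub>C X y) = (\<Sum>y\<in>range s. y * (LINT t|m. f t * indicator (s -` {y}) t * h x' t))"
        using X x' by (auto simp: I_def cdualD(3,6))
      also have "\<dots> = (LINT t|m. (\<Sum>y\<in>range s. y * (f t * indicator (s -` {y}) t * h x' t)))"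
        using int by simp
      also have "\<dots> = (LINT t|m. f t * s t * h x' t)"
      proof (rule Bochner_Integration.integral_cong[OF refl])
        fix t
        have "f t * s t * h x' t = f t * (\<Sum>y\<in>range s. indicator (s -` {y}) t * y) * h x' t"
          by (simp only: finite_range_representation[OF fin, of t, symmetric])
        then show "(\<Sum>y\<in>range s. y * (f t * indicator (s -` {y}) t * h x' t)) = f t * s t * h x' t"
          by (simp add: sum_distrib_left sum_distrib_right ac_simps)
      qed
      finally show ?thesis .
    qed
    then show ?thesis by (auto simp: I_def)
  qed
  obtain C where C: "\<And>\<phi> x. \<phi> \<in> borel_measurable borel \<Longrightarrow> (\<And>t. cmod (\<phi> t) \<le> 1) \<Longrightarrow> I \<phi> x \<Longrightarrow> norm x \<le> C"
  proof -
    let ?S = "{x. \<exists>\<phi>\<in>borel_measurable borel. (\<forall>t. cmod (\<phi> t) \<le> 1) \<and> I \<phi> x}"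
    have "\<exists>C. \<forall>x\<in>?S. norm x \<le> C"
    proof (rule weakly_bounded_imp_norm_bounded)
      fix x' :: "'x \<Rightarrow> complex" assume x': "x' \<in> cdual"
      have "cmod (x' x) \<le> 1 * (LINT t|m. cmod (f t * h x' t))" if "x \<in> ?S" for x
        using that fh(2)[OF x', of _ 1] x' by (auto simp: I_def)
      then show "\<exists>B. \<forall>x\<in>?S. cmod (x' x) \<le> B" by blast
    qed
    then show ?thesis using that by blast
  qed
  have bound: "norm x \<le> \<epsilon> * C" if "0 < \<epsilon>" "\<phi> \<in> borel_measurable borel" "\<And>t. cmod (\<phi> t) \<le> \<epsilon>" "I \<phi> x" for \<phi> \<epsilon> x
  proof -
    have "norm (of_real (1 / \<epsilon>) *\<^sub>C x) \<le> C"
      using that by (intro C[OF _ _ I_scale[OF that(4)]]) (auto simp: norm_mult norm_divide)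
    then show ?thesis using that(1) by (simp add: norm_scaleC norm_divide field_simps)
  qed
  have "\<exists>s. s \<in> borel_measurable borel \<and> finite (range s) \<and> (\<forall>t. cmod (s t - \<phi> t) \<le> 1 / Suc n)" for n
    using uniform_simple_approximation[OF \<phi> B, of "1 / Suc n"] by (auto simp del: of_nat_Suc)
  then obtain s where s: "\<And>n. s n \<in> borel_measurable borel" "\<And>n. finite (range (s n))"
    "\<And>n t. cmod (s n t - \<phi> t) \<le> 1 / Suc n" by metis
  obtain X where X: "\<And>n. I (s n) (X n)" using I_simple[OF s(1,2)] by metis
  have sB: "cmod (s n t) \<le> B + 1" for n t
  proof -
    have "cmod (s n t) \<le> cmod (\<phi> t) + cmod (s n t - \<phi> t)" using norm_triangle_sub by blast
    also have "\<dots> \<le> B + 1" using B[of t] s(3)[of n t] by (smt (verit) divide_le_eq_1 of_nat_0_le_iff of_nat_Suc)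
    finally show ?thesis .
  qed
  have "Cauchy X"
    unfolding Cauchy_altdef2 
  proof (intro allI impI)
    fix e :: real assume e: "0 < e"
    obtain N :: nat where N: "2 * C / e < real N" using reals_Archimedean2 by blast
    have "dist (X n) (X N) < e" if n: "N \<le> n" for n
    proof -
      have "cmod (s n t - s N t) \<le> 2 / Suc N" for t
      proof -
        have "cmod (s n t - s N t) \<le> cmod (s n t - \<phi> t) + cmod (s N t - \<phi> t)"
          using norm_triangle_ineq4[of "s n t - \<phi> t" "s N t - \<phi> t"] by simp
        also have "\<dots> \<le> 1 / Suc n + 1 / Suc N" by (intro add_mono s(3))
        also have "\<dots> \<le> 1 / Suc N + 1 / Suc N" using n by (intro add_mono divide_left_mono) auto
        finally show ?thesis by simp
      qed
      then have "norm (X n - X N) \<le> 2 / Suc N * C"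
        using s(1) I_diff[OF X X s(1) s(1) sB sB, of n N]
        by (intro bound[where \<phi> = "\<lambda>t. s n t - s N t"]) auto
      also have "\<dots> < e" using N e by (simp add: field_simps)
      finally show ?thesis by (simp add: dist_norm)
    qed
    then show "\<exists>N. \<forall>n\<ge>N. dist (X n) (X N) < e" by blast
  qed
  then obtain x where x: "X \<longlonglongrightarrow> x" using Cauchy_convergent_iff convergent_def by blast
  have "I \<phi> x"
    unfolding I_def
  proof
    fix x' :: "'x \<Rightarrow> complex" assume x': "x' \<in> cdual"
    have "(\<lambda>n. x' (X n)) \<longlonglongrightarrow> x' x" by (rule bounded_linear.tendsto[OF cdualD(1)[OF x'] x])
    moreover have "(\<lambda>n. x' (X n)) \<longlonglongrightarrow> (LINT t|m. f t * \<phi> t * h x' t)"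
    proof (rule LIM_zero_cancel, rule Lim_null_comparison)
      let ?K = "LINT t|m. cmod (f t * h x' t)"
      have "cmod (x' (X n) - (LINT t|m. f t * \<phi> t * h x' t)) \<le> 1 / Suc n * ?K" for n
      proof -
        have "x' (X n) - (LINT t|m. f t * \<phi> t * h x' t) = (LINT t|m. f t * (s n t - \<phi> t) * h x' t)"
          using X[of n] x' fh(1)[OF x' \<phi> B] fh(1)[OF x' s(1) sB, of n]
          by (simp add: I_def left_diff_distrib right_diff_distrib)
        also have "cmod \<dots> \<le> 1 / Suc n * ?K"
          using s \<phi> by (intro fh(2) x') auto
        finally show ?thesis .
      qed
      then show "\<forall>\<^sub>F n in sequentially. norm (x' (X n) - (LINT t|m. f t * \<phi> t * h x' t)) \<le> 1 / Suc n * ?K"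
        by (intro always_eventually allI)
      show "(\<lambda>n. 1 / Suc n * ?K) \<longlonglongrightarrow> 0"
        using tendsto_mult_left_zero[OF LIMSEQ_Suc[OF lim_1_over_n], of ?K] by simp
    qed
    ultimately show "x' x = (LINT t|m. f t * \<phi> t * h x' t)" by (rule LIMSEQ_unique)
  qed
  moreover have "y = x" if "I \<phi> y" for y
  proof (rule separated)
    fix x' :: "'x \<Rightarrow> complex" assume "x' \<in> cdual"
    then show "x' y = x' x" using that \<open>I \<phi> x\<close> unfolding I_def by metis
  qed
  ultimately have "vm_integral \<nu> UNIV (\<lambda>t. f t * \<phi> t) = x"
    unfolding vm_integral_def vm[OF \<phi> B] by (rule the_equality)
  with \<open>I \<phi> x\<close> x' show ?thesis by (simp add: I_def h_def)
qed

section \<open>Matrix coefficients and Fourier transforms\<close>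

text \<open>
By polarization the inner product is a combination of squared norms.
\<close>

lemma continuous_on_cinner_left:
  fixes y :: "'h::complex_inner"
  shows "continuous_on UNIV (\<lambda>x. cinner x y)"
proof -
  have sq: "(norm x)\<^sup>2 = Re (cinner x x)" for x :: 'h
    using norm_eq_sqrt_cinner[of x] norm_ge_zero[of x] by (metis real_sqrt_ge_0_iff real_sqrt_pow2)
  have addr: "cinner x (y + z) = cinner x y + cinner x z" for x y z :: 'h
    by (metis cinner_add_left cinner_commute complex_cnj_add)
  have polar: "Re (cinner x z) = ((norm (x + z))\<^sup>2 - (norm x)\<^sup>2 - (norm z)\<^sup>2) / 2" for x z :: 'h
    using cinner_commute[of x z] by (simp add: sq cinner_add_left addr complex_eq_iff)
  have "Im (cinner x z) = Re (cinner x (\<i> *\<^sub>C z))" for x z :: 'h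
  proof -
    have "cinner x (\<i> *\<^sub>C z) = - \<i> * cinner x z"
      by (metis cinner_commute cinner_scaleC_left complex_cnj_i complex_cnj_mult)
    then show ?thesis by simp
  qed
  then have "cinner x y = Complex (((norm (x + y))\<^sup>2 - (norm x)\<^sup>2 - (norm y)\<^sup>2) / 2)
      (((norm (x + \<i> *\<^sub>C y))\<^sup>2 - (norm x)\<^sup>2 - (norm (\<i> *\<^sub>C y))\<^sup>2) / 2)" for x
    by (simp add: polar complex_eq_iff)
  then show ?thesis by (auto simp: Complex_eq intro!: continuous_intros)
qed

lemma dual_object_irreducible:
  assumes "c \<in> dual_object" "\<pi> \<in> c"
  shows "irreducible_rep \<pi>"
  using assms by (cases \<pi>) (auto simp: dual_object_def quotient_def rep_equiv_def)

lemma continuous_rep_coeff: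
  fixes \<pi> :: "('g::topological_group_add, 'h::complex_inner) rep"
  assumes \<pi>: "irreducible_rep \<pi>" and e: "ordered_onb \<pi> e" and j: "j < rep_dim \<pi>"
  shows "continuous_on UNIV (\<lambda>t. rep_coeff \<pi> e t i j)"
proof -
  obtain H \<sigma> where H: "\<pi> = (H, \<sigma>)" by (cases \<pi>)
  have "e j \<in> complex_vs.span (e ` {..<rep_dim (H, \<sigma>)})"
    using j by (intro complex_vs.span_base) (auto simp: H)
  then have "e j \<in> H" using e by (simp add: ordered_onb_def H)
  then have "continuous_on UNIV (\<lambda>t. \<sigma> t (e j))"
    using \<pi> by (auto simp: H irreducible_rep_def unitary_rep_def)
  then show ?thesis
    unfolding H rep_coeff_def prod.case
    by (rule continuous_on_compose2[OF continuous_on_cinner_left]) auto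
qed

theorem mainTheorem4:
  fixes m :: "'g::{topological_group_add, t2_space} measure"
    and \<nu> :: "'g set \<Rightarrow> 'x::{complex_normed_vector, complete_space}"
    and matnorm :: "'x mat \<Rightarrow> real"
    and f :: "'g \<Rightarrow> complex"
    and x' :: "'x \<Rightarrow> complex"
    and c :: "('g, 'h::complex_inner) rep set"
    and \<pi> :: "('g, 'h) rep"
    and e :: "nat \<Rightarrow> 'h"
  assumes "compact (UNIV :: 'g set)"
    and "normalized_haar m"
    and "complete_operator_space matnorm"
    and "\<nu> \<in> M_ac m"
    and "f \<in> L1 \<nu>"
    and "x' \<in> cdual"
    and "c \<in> dual_object" and "\<pi> \<in> c" and "ordered_onb \<pi> e"
  defines "d \<equiv> rep_dim \<pi>"
    and "h \<equiv> density_of m (scalar_measure \<nu> x')"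
  shows "matrix_pairing (fourier_vm \<nu> f \<pi> e) x'
           = Matrix.mat d d (\<lambda>(i, j). x' (fourier_vm \<nu> f \<pi> e $$ (i, j)))
       \<and> Matrix.mat d d (\<lambda>(i, j). x' (fourier_vm \<nu> f \<pi> e $$ (i, j)))
           = Matrix.mat d d (\<lambda>(i, j). fourier m (\<lambda>t. f t * h t) \<pi> e $$ (i, j))
       \<and> Matrix.mat d d (\<lambda>(i, j). fourier m (\<lambda>t. f t * h t) \<pi> e $$ (i, j))
           = fourier m (\<lambda>t. f t * h t) \<pi> e
       \<and> fourier m (\<lambda>t. f t * h t) \<pi> e = fourier_weak m \<nu> f x' \<pi> e"
proof -
  have sets: "sets m = sets borel" using assms(2) by (simp add: normalized_haar_def)
  have "finite_measure m"
    using assms(2) sets_eq_imp_space_eq[OF sets] by (intro finite_measureI) (simp add: normalized_haar_def)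
  then interpret finite_borel_measure m
    using sets by (intro finite_borel_measure.intro finite_borel_measure_axioms.intro)
  have entry: "x' (fourier_vm \<nu> f \<pi> e $$ (i, j)) = fourier m (\<lambda>t. f t * h t) \<pi> e $$ (i, j)"
    if ij: "i < d" "j < d" for i j
  proof -
    let ?\<phi> = "\<lambda>t. cnj (rep_coeff \<pi> e t j i)"
    have "continuous_on UNIV (\<lambda>t. rep_coeff \<pi> e t j i)"
      using assms ij dual_object_irreducible[of c \<pi>] by (intro continuous_rep_coeff) auto
    then have cont: "continuous_on UNIV ?\<phi>" by (intro continuous_intros)
    then have "bounded (range ?\<phi>)"
      using compact_imp_bounded[OF compact_continuous_image[OF cont assms(1)]] by simp
    then obtain B where B: "\<And>t. cmod (?\<phi> t) \<le> B" by (auto simp: bounded_iff)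
    have "x' (vm_integral \<nu> UNIV (\<lambda>t. f t * ?\<phi> t)) = (LINT t|m. f t * ?\<phi> t * h t)"
      unfolding h_def using assms B cont
      by (intro bounded_multiplier_integral borel_measurable_continuous_onI) auto
    then show ?thesis
      using ij cdualD(3)[OF assms(6)]
      by (simp add: fourier_vm_def fourier_def d_def mult.assoc mult.commute[of "h _"])
  qed
  have "matrix_pairing (fourier_vm \<nu> f \<pi> e) x' = Matrix.mat d d (\<lambda>(i, j). x' (fourier_vm \<nu> f \<pi> e $$ (i, j)))"
    by (rule eq_matI) (auto simp: matrix_pairing_def fourier_vm_def d_def)
  moreover have "Matrix.mat d d (\<lambda>(i, j). x' (fourier_vm \<nu> f \<pi> e $$ (i, j)))
      = Matrix.mat d d (\<lambda>(i, j). fourier m (\<lambda>t. f t * h t) \<pi> e $$ (i, j))"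
    by (rule eq_matI) (auto simp: entry)
  moreover have "Matrix.mat d d (\<lambda>(i, j). fourier m (\<lambda>t. f t * h t) \<pi> e $$ (i, j)) = fourier m (\<lambda>t. f t * h t) \<pi> e"
    by (rule eq_matI) (auto simp: fourier_def d_def)
  moreover have "fourier m (\<lambda>t. f t * h t) \<pi> e = fourier_weak m \<nu> f x' \<pi> e"
    by (simp add: fourier_weak_def h_def)
  ultimately show ?thesis by blast
qed

end
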